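(* Let $\mathcal{A}$ be a commutative unital complex Banach algebra with unit $1_\mathcal{A}$, let $a=(a_n)_{n\in\mathbb{N}}\in \ell^1(\mathbb N,\mathcal A)$, and let $f_a(s)=\sum_{n\in \mathbb N} a_n n^{-s}$ for $s \in \mathcal H$. Then the following are equivalent: (i) $a$ is invertible in $\ell^1(\mathbb{N},\mathcal{A})$; (ii) $\overline{\{f_a(s):s\in\mathcal{H}\}}\subset G(\mathcal{A})$, where the closure is taken in $\mathcal A$; (iii) there is $(b_n)_{n\in\mathbb{N}} \in \ell^1(\mathbb N,\mathcal A)$ such that $(f_a(s))^{-1}=\sum_{n\in\mathbb{N}} b_n n^{-s}$ for all $s\in\mathcal{H}$. In particular, a function $f\in\mathcal{D}(\mathbb{N},\mathcal{A})$ is invertible in $\mathcal{D}(\mathbb{N},\mathcal{A})$ if and only if $\overline{\{f(s):s\in\mathcal H\}}\subset G(\mathcal{A})$.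
   Context: $\mathcal{H}=\{s\in\mathbb C:\operatorname{Re}s\geq 0\}$. $G(\mathcal A)$ denotes the set of invertible elements of $\mathcal A$. $\ell^1(\mathbb N,\mathcal A)$ is the set of sequences $(a_n)_{n\in\mathbb N}$ in $\mathcal A$ with $\|a\|_1=\sum_n\|a_n\|<\infty$, a unital Banach algebra under the Dirichlet convolution $(a\star b)_n=\sum_{k,l\in\mathbb N,\,kl=n}a_kb_l$ (unit: the sequence with $1_\mathcal A$ at $n=1$ and $0$ elsewhere). $\mathcal D(\mathbb N,\mathcal A)$ is the set of functions $f:\mathcal H\to\mathcal A$ of the form $f(s)=\sum_{n\in\mathbb N}f_n n^{-s}$ with $f_n\in\mathcal A$ and $\sum_n\|f_n\|<\infty$; it is a unital Banach algebra under pointwise multiplication and the norm $\sum_n\|f_n\|$, isometrically isomorphic to $\ell^1(\mathbb N,\mathcal A)$ via $(f_n)\mapsto f$. *)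

theory Defs
  imports "HOL-Analysis.Analysis"
begin

class comm_complex_banach_algebra_1 = banach + real_normed_algebra_1 + comm_ring_1 +
  fixes scaleC :: "complex \<Rightarrow> 'a \<Rightarrow> 'a"
  assumes scaleC_of_real: "scaleC (of_real r) x = scaleR r x"
    and scaleC_add_right: "scaleC c (x + y) = scaleC c x + scaleC c y"
    and scaleC_add_left: "scaleC (c + d) x = scaleC c x + scaleC d x"
    and scaleC_scaleC: "scaleC c (scaleC d x) = scaleC (c * d) x"
    and scaleC_one: "scaleC 1 x = x"
    and norm_scaleC: "norm (scaleC c x) = cmod c * norm x"
    and mult_scaleC_left: "scaleC c x * y = scaleC c (x * y)"
    and mult_scaleC_right: "x * scaleC c y = scaleC c (x * y)"

definition halfplane :: "complex set" where
  "halfplane = {s. Re s \<ge> 0}"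

definition Gunits :: "'a::ring_1 set" where
  "Gunits = {x. \<exists>y. x * y = 1 \<and> y * x = 1}"

text \<open>ell^1(N, A), N = {1,2,...}: sequences indexed by nat with the (unused) entry 0 equal to 0.\<close>
definition ell1 :: "(nat \<Rightarrow> 'a::real_normed_vector) set" where
  "ell1 = {a. a 0 = 0 \<and> summable (\<lambda>n. norm (a n))}"

definition dconv :: "(nat \<Rightarrow> 'a::comm_ring_1) \<Rightarrow> (nat \<Rightarrow> 'a) \<Rightarrow> nat \<Rightarrow> 'a" where
  "dconv a b n = (\<Sum>(k, l) \<in> {(k, l). k * l = n}. a k * b l)"

definition dunit :: "nat \<Rightarrow> 'a::comm_ring_1" where
  "dunit n = (if n = 1 then 1 else 0)"

definition ell1_invertible :: "(nat \<Rightarrow> 'a::comm_complex_banach_algebra_1) \<Rightarrow> bool" where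
  "ell1_invertible a \<longleftrightarrow> (\<exists>b \<in> ell1. dconv a b = dunit \<and> dconv b a = dunit)"

definition dser :: "(nat \<Rightarrow> 'a::comm_complex_banach_algebra_1) \<Rightarrow> complex \<Rightarrow> 'a" where
  "dser a s = (\<Sum>n. scaleC (of_nat n powr (- s)) (a n))"

text \<open>D(N, A): functions on H (values off H irrelevant) given by an absolutely convergent Dirichlet series.\<close>
definition Dfun :: "(complex \<Rightarrow> 'a::comm_complex_banach_algebra_1) set" where
  "Dfun = {f. \<exists>c \<in> ell1. \<forall>s \<in> halfplane. f s = dser c s}"

end

theory Submission
  imports Defs "HOL-Real_Asymp.Real_Asymp"
begin

text \<open>
  Only the implication from the condition on the range to invertibility is hard. The closure of the
  range is compact, so the inverses of its elements are bounded by some \<open>M\<close>. Approximate \<open>a\<close> in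
  \<open>\<ell>\<^sup>1\<close> by a finitely supported \<open>p\<close>, whose values then have inverses bounded by \<open>2 * M\<close>, and
  consider the twists \<open>p\<^sub>\<sigma>(n) = p(n) * n powr (- \<sigma>)\<close>. If \<open>p\<^sub>\<sigma>\<close> has an inverse \<open>q\<close>, the coefficients of
  \<open>q ^ k\<close> are bounded by the supremum of the series on the imaginary axis. Applying this also to
  derivatives of \<open>q ^ k\<close> under the derivations \<open>c(n) \<mapsto> v\<^sub>r(n) * c(n)\<close> (\<open>v\<^sub>r\<close> the \<open>r\<close>-adic valuation)
  for the finitely many primes \<open>r\<close> involved in \<open>p\<close>, which is possible since \<open>D q = - q\<^sup>2 * D p\<close>,
  gives enough decay to bound the norm of \<open>q ^ k\<close> by \<open>C * (k + 1) ^ J * (2 * M) ^ k\<close>, uniformly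
  in \<open>\<sigma>\<close>. For \<open>k = 1\<close> this bound lets invertibility descend from \<open>\<sigma> = \<infinity>\<close>, where the twist is
  the constant \<open>p(1)\<close>, to \<open>\<sigma> = 0\<close>. For all \<open>k\<close> it gives convergence of the Neumann series for the
  inverse of \<open>a\<close> around \<open>p\<close>, as in Newman's proof of Wiener's lemma.
\<close>

section \<open>Dirichlet convolution\<close>

lemma finite_factor_pairs:
  fixes n :: nat
  assumes "n > 0"
  shows "finite {(k, l). k * l = n}"
proof (rule finite_subset)
  show "{(k, l). k * l = n} \<subseteq> {..n} \<times> {..n}"
  proof clarify
    fix k l assume "n = k * l"
    then show "k \<in> {..k * l} \<and> l \<in> {..k * l}" using assms by (cases k; cases l) auto
  qed
qed auto

text \<open>The set of factor pairs of 0 is infinite, so the defining sum takes its default value 0.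
  Thus a convolution always respects the convention that the entry at index 0 vanishes.\<close>

lemma dconv_at_0 [simp]: "dconv a b 0 = 0"
proof -
  have "range (\<lambda>k. (k, 0)) \<subseteq> {(k, l :: nat). k * l = 0}" by auto
  moreover have "infinite (range (\<lambda>k::nat. (k, 0 :: nat)))"
    by (rule range_inj_infinite) (auto simp: inj_on_def)
  ultimately have "infinite {(k, l :: nat). k * l = 0}" using finite_subset by blast
  then show ?thesis unfolding dconv_def by simp
qed

lemma dconv_commute: "dconv a b = dconv b a"
proof
  fix n show "dconv a b n = dconv b a n"
    unfolding dconv_def
    by (rule sum.reindex_bij_witness[of _ prod.swap prod.swap]) (auto simp: mult.commute)
qed

lemma dconv_add_left: "dconv (\<lambda>n. a n + b n) c = (\<lambda>n. dconv a c n + dconv b c n)"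
  unfolding dconv_def by (simp add: case_prod_unfold distrib_right sum.distrib)

lemma dconv_unit_left:
  assumes "a 0 = 0" shows "dconv dunit a = a"
proof
  fix n show "dconv dunit a n = a n"
  proof (cases "n = 0")
    case False
    have "dconv dunit a n = (\<Sum>(k, l) \<in> {(1, n)}. dunit k * a l)"
      unfolding dconv_def using False
      by (intro sum.mono_neutral_right finite_factor_pairs) (auto simp: dunit_def split: if_splits)
    then show ?thesis by (simp add: dunit_def)
  qed (simp add: assms)
qed

text \<open>Both sides sum over the factorisations of \<open>n\<close> into three factors; the
  bijection regroups \<open>(i * j) * l\<close> as \<open>i * (j * l)\<close>.\<close>

lemma dconv_assoc: "dconv (dconv a b) c = dconv a (dconv b c)"
proof
  fix n show "dconv (dconv a b) c n = dconv a (dconv b c) n"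
  proof (cases "n = 0")
    case False
    define S where "S = (\<lambda>n::nat. {(k, l). k * l = n})"
    have fS: "finite (S n)" if "n > 0" for n using finite_factor_pairs[OF that] by (simp add: S_def)
    have pos: "m > 0 \<and> l > 0" if "(m, l) \<in> S n" for m l using that False by (auto simp: S_def)
    have "dconv (dconv a b) c n = (\<Sum>x\<in>S n. \<Sum>y\<in>S (fst x). a (fst y) * b (snd y) * c (snd x))"
      unfolding dconv_def S_def by (simp add: case_prod_unfold sum_distrib_right)
    also have "\<dots> = (\<Sum>(x, y)\<in>Sigma (S n) (\<lambda>x. S (fst x)). a (fst y) * b (snd y) * c (snd x))"
      using pos False by (intro sum.Sigma) (auto intro!: fS)
    also have "\<dots> = (\<Sum>(x, y)\<in>Sigma (S n) (\<lambda>x. S (snd x)). a (fst x) * (b (fst y) * c (snd y)))"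
      by (rule sum.reindex_bij_witness[of _
            "\<lambda>((i, m), (j, l)). ((i * j, l), (i, j))" "\<lambda>((m, l), (i, j)). ((i, j * l), (j, l))"])
         (auto simp: S_def mult.assoc)
    also have "\<dots> = (\<Sum>x\<in>S n. \<Sum>y\<in>S (snd x). a (fst x) * (b (fst y) * c (snd y)))"
      using pos False by (intro sum.Sigma[symmetric]) (auto intro!: fS)
    also have "\<dots> = dconv a (dconv b c) n"
      unfolding dconv_def S_def by (simp add: case_prod_unfold sum_distrib_left)
    finally show ?thesis .
  qed simp
qed

text \<open>A pair with positive product below \<open>N\<close> has both entries below
  \<open>N\<close> and occurs for one product only, so the pairs on the left embed into a square.
  Working with partial sums gives membership in \<open>ell1\<close> and the norm bound at the same
  time.\<close>

lemma sum_norm_dconv_le: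
  fixes a b :: "nat \<Rightarrow> 'a::{comm_ring_1, real_normed_algebra_1}"
  shows "(\<Sum>n<N. norm (dconv a b n)) \<le> (\<Sum>n<N. norm (a n)) * (\<Sum>n<N. norm (b n))"
proof -
  define S where "S = (\<lambda>n::nat. {(k, l). k * l = n})"
  have fS: "finite (S n)" if "n > 0" for n using finite_factor_pairs[OF that] by (simp add: S_def)
  have le: "k \<le> k * l \<and> l \<le> k * l" if "k * l > 0" for k l :: nat
    using that by (cases k; cases l) auto
  have "(\<Sum>n<N. norm (dconv a b n)) = (\<Sum>n\<in>{0<..<N}. norm (dconv a b n))"
    by (intro sum.mono_neutral_right) (auto simp: not_less)
  also have "\<dots> \<le> (\<Sum>n\<in>{0<..<N}. \<Sum>x\<in>S n. norm (a (fst x)) * norm (b (snd x)))"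
    unfolding dconv_def S_def
    by (intro sum_mono sum_norm_le) (auto simp: case_prod_unfold norm_mult_ineq)
  also have "\<dots> = (\<Sum>(n, x)\<in>Sigma {0<..<N} S. norm (a (fst x)) * norm (b (snd x)))"
    by (intro sum.Sigma) (auto intro!: fS)
  also have "\<dots> = (\<Sum>x\<in>snd ` Sigma {0<..<N} S. norm (a (fst x)) * norm (b (snd x)))"
    by (subst sum.reindex) (auto simp: inj_on_def S_def case_prod_unfold)
  also have "\<dots> \<le> (\<Sum>x\<in>{..<N} \<times> {..<N}. norm (a (fst x)) * norm (b (snd x)))"
  proof (rule sum_mono2)
    show "snd ` Sigma {0<..<N} S \<subseteq> {..<N} \<times> {..<N}"
    proof (rule image_subsetI)
      fix x assume "x \<in> Sigma {0<..<N} S"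
      then obtain k l where "x = (k * l, k, l)" "k * l > 0" "k * l < N" by (auto simp: S_def)
      then show "snd x \<in> {..<N} \<times> {..<N}" using le[OF \<open>k * l > 0\<close>] by (simp add: le_less_trans[OF _ \<open>k * l < N\<close>])
    qed
  qed auto
  also have "\<dots> = (\<Sum>n<N. norm (a n)) * (\<Sum>n<N. norm (b n))"
    by (simp add: sum_product sum.cartesian_product case_prod_unfold)
  finally show ?thesis .
qed

section \<open>The Banach algebra of absolutely convergent Dirichlet series\<close>

text \<open>As a type, the sequences can be made an instance of the Banach algebra classes, which
  supplies powers, ring simplification and limits.\<close>

typedef (overloaded) 'a ell = "ell1 :: (nat \<Rightarrow> 'a::real_normed_vector) set"
  morphisms coeff Ell
  by (rule exI[of _ "\<lambda>_. 0"]) (auto simp: ell1_def)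

setup_lifting type_definition_ell

lemma coeff_0 [simp]: "coeff a 0 = 0"
  using coeff[of a] by (simp add: ell1_def)

lemma summable_norm_coeff [simp]: "summable (\<lambda>n. norm (coeff a n))"
  using coeff[of a] by (simp add: ell1_def)

lemma ell_eqI: "(\<And>n. coeff a n = coeff b n) \<Longrightarrow> a = b"
  by (simp add: coeff_inject[symmetric] fun_eq_iff)

instantiation ell :: (real_normed_vector) real_normed_vector
begin

lift_definition zero_ell :: "'a ell" is "\<lambda>_. 0" by (auto simp: ell1_def)

lift_definition plus_ell :: "'a ell \<Rightarrow> 'a ell \<Rightarrow> 'a ell" is "\<lambda>a b n. a n + b n"
proof -
  fix a b :: "nat \<Rightarrow> 'a" assume ab: "a \<in> ell1" "b \<in> ell1"
  then have "summable (\<lambda>n. norm (a n) + norm (b n))" by (auto simp: ell1_def intro: summable_add)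
  then have "summable (\<lambda>n. norm (a n + b n))"
    by (rule summable_comparison_test') (auto simp: norm_triangle_ineq)
  then show "(\<lambda>n. a n + b n) \<in> ell1" using ab by (auto simp: ell1_def)
qed

lift_definition uminus_ell :: "'a ell \<Rightarrow> 'a ell" is "\<lambda>a n. - a n" by (auto simp: ell1_def)

definition minus_ell :: "'a ell \<Rightarrow> 'a ell \<Rightarrow> 'a ell" where "minus_ell a b = a + - b"

lift_definition scaleR_ell :: "real \<Rightarrow> 'a ell \<Rightarrow> 'a ell" is "\<lambda>r a n. r *\<^sub>R a n"
  by (auto simp: ell1_def intro: summable_mult)

definition norm_ell :: "'a ell \<Rightarrow> real" where "norm_ell a = (\<Sum>n. norm (coeff a n))"

definition dist_ell :: "'a ell \<Rightarrow> 'a ell \<Rightarrow> real" where "dist_ell a b = norm (a - b)"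

definition sgn_ell :: "'a ell \<Rightarrow> 'a ell" where "sgn_ell a = scaleR (inverse (norm a)) a"

definition uniformity_ell :: "('a ell \<times> 'a ell) filter" where
  "uniformity_ell = (INF e\<in>{0 <..}. principal {(x, y). dist x y < e})"

definition open_ell :: "'a ell set \<Rightarrow> bool" where
  "open_ell U = (\<forall>x\<in>U. eventually (\<lambda>(x', y). x' = x \<longrightarrow> y \<in> U) uniformity)"

instance
proof
  fix a b c :: "'a ell" and r s :: real
  show "a + b + c = a + (b + c)" by transfer (simp add: add.assoc)
  show "a + b = b + a" by transfer (simp add: add.commute)
  show "0 + a = a" by transfer simp
  show "- a + a = 0" by transfer simp
  show "a - b = a + - b" by (simp add: minus_ell_def)
  show "r *\<^sub>R (a + b) = r *\<^sub>R a + r *\<^sub>R b" by transfer (simp add: scaleR_add_right)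
  show "(r + s) *\<^sub>R a = r *\<^sub>R a + s *\<^sub>R a" by transfer (simp add: scaleR_add_left)
  show "r *\<^sub>R s *\<^sub>R a = (r * s) *\<^sub>R a" by transfer simp
  show "1 *\<^sub>R a = a" by transfer simp
  show "(norm a = 0) = (a = 0)"
    unfolding norm_ell_def
    by (subst suminf_eq_zero_iff) (auto simp: zero_ell.rep_eq coeff_inject[symmetric] fun_eq_iff)
  have "norm (a + b) \<le> (\<Sum>n. norm (coeff a n) + norm (coeff b n))"
    unfolding norm_ell_def
    by (rule suminf_le[OF _ summable_norm_coeff summable_add[OF summable_norm_coeff summable_norm_coeff]])
       (simp add: plus_ell.rep_eq norm_triangle_ineq)
  then show "norm (a + b) \<le> norm a + norm b"
    by (simp add: norm_ell_def suminf_add)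
  show "norm (r *\<^sub>R a) = \<bar>r\<bar> * norm a"
    unfolding norm_ell_def by (simp add: scaleR_ell.rep_eq suminf_mult)
qed (simp_all add: dist_ell_def sgn_ell_def uniformity_ell_def open_ell_def)

end

lemma coeff_zero [simp]: "coeff 0 n = 0" by (simp add: zero_ell.rep_eq)
lemma coeff_add [simp]: "coeff (a + b) n = coeff a n + coeff b n" by (simp add: plus_ell.rep_eq)
lemma coeff_minus [simp]: "coeff (- a) n = - coeff a n" by (simp add: uminus_ell.rep_eq)
lemma coeff_diff [simp]: "coeff (a - b) n = coeff a n - coeff b n"
  unfolding diff_conv_add_uminus coeff_add coeff_minus by simp
lemma coeff_scaleR [simp]: "coeff (r *\<^sub>R a) n = r *\<^sub>R coeff a n" by (simp add: scaleR_ell.rep_eq)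

lemma sum_norm_coeff_le: "finite F \<Longrightarrow> (\<Sum>n\<in>F. norm (coeff a n)) \<le> norm a"
  unfolding norm_ell_def by (rule sum_le_suminf) auto

lemma norm_coeff_le: "norm (coeff a n) \<le> norm a"
  using sum_norm_coeff_le[of "{n}" a] by simp

lemma ell_normI:
  assumes "f 0 = 0" "\<And>N. (\<Sum>n<N. norm (f n)) \<le> B"
  shows "f \<in> ell1" "norm (Ell f) \<le> B"
proof -
  have s: "summable (\<lambda>n. norm (f n))"
    by (rule summableI_nonneg_bounded[OF _ assms(2)]) auto
  then show f: "f \<in> ell1" using assms(1) by (simp add: ell1_def)
  show "norm (Ell f) \<le> B"
    unfolding norm_ell_def Ell_inverse[OF f] by (rule suminf_le_const[OF s assms(2)])
qed

lemma norm_ell_leI: "(\<And>N. (\<Sum>n<N. norm (coeff a n)) \<le> B) \<Longrightarrow> norm a \<le> B"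
  using ell_normI(2)[of "coeff a" B] by (simp add: coeff_inverse)

text \<open>A Cauchy sequence converges coefficientwise; estimates on finite partial sums survive
  this limit and give convergence in norm.\<close>

instance ell :: (banach) banach
proof
  fix X :: "nat \<Rightarrow> 'a ell" assume X: "Cauchy X"
  have "Cauchy (\<lambda>i. coeff (X i) n)" for n
  proof (rule metric_CauchyI)
    fix e :: real assume "e > 0"
    then obtain M where M: "\<forall>i\<ge>M. \<forall>j\<ge>M. dist (X i) (X j) < e"
      using X metric_CauchyD by blast
    show "\<exists>M. \<forall>i\<ge>M. \<forall>j\<ge>M. dist (coeff (X i) n) (coeff (X j) n) < e"
    proof (intro exI allI impI)
      fix i j assume "i \<ge> M" "j \<ge> M"
      then have "norm (X i - X j) < e" using M by (auto simp: dist_norm)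
      then show "dist (coeff (X i) n) (coeff (X j) n) < e"
        using norm_coeff_le[of "X i - X j" n] by (simp add: dist_norm)
    qed
  qed
  then have "\<forall>n. \<exists>l. (\<lambda>i. coeff (X i) n) \<longlonglongrightarrow> l"
    by (simp add: Cauchy_convergent_iff convergent_def)
  then obtain L where L: "\<And>n. (\<lambda>i. coeff (X i) n) \<longlonglongrightarrow> L n" by metis
  have L0: "L 0 = 0" using L[of 0] by (simp add: LIMSEQ_const_iff)
  have bound: "(\<Sum>n<N. norm (L n - coeff (X i) n)) \<le> e"
    if "\<forall>j\<ge>i. norm (X j - X i) < e" for e i N
  proof (rule LIMSEQ_le_const2)
    show "(\<lambda>j. \<Sum>n<N. norm (coeff (X j) n - coeff (X i) n)) \<longlonglongrightarrow> (\<Sum>n<N. norm (L n - coeff (X i) n))"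
      by (intro tendsto_intros L)
    show "\<exists>M. \<forall>j\<ge>M. (\<Sum>n<N. norm (coeff (X j) n - coeff (X i) n)) \<le> e"
    proof (intro exI allI impI)
      fix j assume "j \<ge> i"
      then have "norm (X j - X i) < e" using that by auto
      then show "(\<Sum>n<N. norm (coeff (X j) n - coeff (X i) n)) \<le> e"
        using sum_norm_coeff_le[of "{..<N}" "X j - X i"] by simp
    qed
  qed
  have ev: "\<exists>i. \<forall>j\<ge>i. norm (X j - X i) < e" if "e > 0" for e
    using X that unfolding Cauchy_altdef2 dist_norm by blast
  obtain i where i: "\<forall>j\<ge>i. norm (X j - X i) < 1" using ev[of 1] by auto
  \<comment> \<open>\<open>L\<close> differs from \<open>X i\<close> by a sequence whose partial
    sums of norms are at most 1, so \<open>L\<close> itself belongs to \<open>ell1\<close>.\<close>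
  have "(\<lambda>n. L n - coeff (X i) n) \<in> ell1"
    by (rule ell_normI(1)[OF _ bound[OF i]]) (simp add: L0)
  then have "coeff (Ell (\<lambda>n. L n - coeff (X i) n) + X i) = L"
    by (simp add: fun_eq_iff Ell_inverse)
  then obtain l where l: "coeff l = L" by metis
  have "X \<longlonglongrightarrow> l"
  proof (rule metric_LIMSEQ_I)
    fix e :: real assume "e > 0"
    then obtain i where i: "\<forall>j\<ge>i. norm (X j - X i) < e / 4" using ev[of "e / 4"] by auto
    have "norm (X j - l) < e" if "j \<ge> i" for j
    proof -
      have "norm (l - X i) \<le> e / 4"
        by (rule norm_ell_leI) (use bound[OF i] in \<open>simp add: l\<close>)
      moreover have "norm (X j - l) \<le> norm (X j - X i) + norm (l - X i)"
        using dist_triangle2[of "X j" l "X i"] by (simp add: dist_norm)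
      moreover have "norm (X j - X i) < e / 4" using i that by auto
      ultimately show ?thesis using \<open>e > 0\<close> by linarith
    qed
    then show "\<exists>no. \<forall>n\<ge>no. dist (X n) l < e" by (auto simp: dist_norm)
  qed
  then show "convergent X" by (auto simp: convergent_def)
qed

lemma dconv_in_ell1:
  fixes a b :: "'a::{comm_ring_1, real_normed_algebra_1} ell"
  shows "dconv (coeff a) (coeff b) \<in> ell1" "norm (Ell (dconv (coeff a) (coeff b))) \<le> norm a * norm b"
proof -
  have "(\<Sum>n<N. norm (dconv (coeff a) (coeff b) n)) \<le> norm a * norm b" for N
    by (rule order_trans[OF sum_norm_dconv_le]) (intro mult_mono sum_norm_coeff_le, auto intro: sum_nonneg)
  from ell_normI[OF dconv_at_0 this]
  show "dconv (coeff a) (coeff b) \<in> ell1" "norm (Ell (dconv (coeff a) (coeff b))) \<le> norm a * norm b"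
    by auto
qed

lemma dunit_in_ell1: "(dunit :: nat \<Rightarrow> 'a::{comm_ring_1, real_normed_algebra_1}) \<in> ell1"
  unfolding ell1_def dunit_def using summable_finite[of "{1}" "\<lambda>n. norm (if n = 1 then 1 else 0 :: 'a)"]
  by auto

instantiation ell :: ("{comm_ring_1, real_normed_algebra_1}") "{comm_ring_1, real_normed_algebra_1}"
begin

lift_definition one_ell :: "'a ell" is dunit by (rule dunit_in_ell1)

definition times_ell :: "'a ell \<Rightarrow> 'a ell \<Rightarrow> 'a ell" where
  "times_ell a b = Ell (dconv (coeff a) (coeff b))"

lemma coeff_times: "coeff (a * b) = dconv (coeff a) (coeff b)"
  unfolding times_ell_def by (simp add: Ell_inverse dconv_in_ell1)

instance
proof
  fix a b c :: "'a ell" and r :: real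
  show "a * b * c = a * (b * c)"
    by (simp add: coeff_inject[symmetric] coeff_times dconv_assoc)
  show ab: "a * b = b * a" for a b :: "'a ell"
    by (simp add: coeff_inject[symmetric] coeff_times dconv_commute)
  show one: "1 * a = a" for a :: "'a ell"
    by (simp add: coeff_inject[symmetric] coeff_times one_ell.rep_eq dconv_unit_left)
  show "a * 1 = a" by (metis ab one)
  show distr: "(a + b) * c = a * c + b * c" for a b c :: "'a ell"
    by (rule ell_eqI) (simp add: coeff_times dconv_add_left plus_ell.rep_eq)
  show "a * (b + c) = a * b + a * c" by (metis ab distr)
  show "(0::'a ell) \<noteq> 1"
    by (metis coeff_zero one_ell.rep_eq dunit_def zero_neq_one)
  show s: "r *\<^sub>R a * b = r *\<^sub>R (a * b)" for a b :: "'a ell"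
    by (rule ell_eqI) (simp add: coeff_times dconv_def scaleR_ell.rep_eq scaleR_sum_right case_prod_unfold)
  show "a * r *\<^sub>R b = r *\<^sub>R (a * b)" by (metis ab s)
  show "norm (a * b) \<le> norm a * norm b" unfolding times_ell_def by (rule dconv_in_ell1)
  have "norm (1 :: 'a ell) = (\<Sum>n\<in>{1}. norm (dunit n :: 'a))"
    unfolding norm_ell_def one_ell.rep_eq by (rule suminf_finite) (auto simp: dunit_def)
  then show "norm (1 :: 'a ell) = 1" by (simp add: dunit_def)
qed

end

section \<open>Evaluation of Dirichlet series\<close>

lemma bounded_bilinear_scaleC:
  "bounded_bilinear (scaleC :: complex \<Rightarrow> 'a \<Rightarrow> 'a::comm_complex_banach_algebra_1)"
proof
  fix r :: real and c d :: complex and x y :: 'a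
  show "scaleC (c + d) x = scaleC c x + scaleC d x" by (rule scaleC_add_left)
  show "scaleC c (x + y) = scaleC c x + scaleC c y" by (rule scaleC_add_right)
  show "scaleC (r *\<^sub>R c) x = r *\<^sub>R scaleC c x"
    by (simp add: scaleR_conv_of_real[of r c] scaleC_scaleC flip: scaleC_of_real)
  show "scaleC c (r *\<^sub>R x) = r *\<^sub>R scaleC c x"
    by (simp add: scaleC_scaleC mult.commute flip: scaleC_of_real)
  show "\<exists>K. \<forall>c x. norm (scaleC c x :: 'a) \<le> norm c * norm x * K"
    by (intro exI[of _ 1]) (simp add: norm_scaleC)
qed

lemmas scaleC_sum_left = bounded_bilinear.sum_left[OF bounded_bilinear_scaleC]
lemmas scaleC_sum_right = bounded_bilinear.sum_right[OF bounded_bilinear_scaleC]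
lemmas scaleC_zero_left = bounded_bilinear.zero_left[OF bounded_bilinear_scaleC]
lemmas scaleC_zero_right = bounded_bilinear.zero_right[OF bounded_bilinear_scaleC]
lemmas scaleC_scaleR_right = bounded_bilinear.scaleR_right[OF bounded_bilinear_scaleC]

lemma norm_powr_halfplane_le:
  assumes "s \<in> halfplane" shows "cmod (of_nat n powr (- s)) \<le> 1"
proof (cases "n = 0")
  case False
  then have "cmod (of_nat n powr (- s)) = real n powr (- Re s)"
    using norm_powr_real_powr[of "of_nat n" "- s"] by simp
  also have "\<dots> \<le> 1" using False assms powr_mono[of "- Re s" 0 "real n"] by (simp add: halfplane_def)
  finally show ?thesis .
qed simp

lemma of_nat_mult_powr:
  "(of_nat (m * n) :: complex) powr s = of_nat m powr s * of_nat n powr s"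
  using powr_times_real[of "of_nat m" "of_nat n" s] by simp

lemma norm_dser_term_le:
  fixes c :: "nat \<Rightarrow> 'a::comm_complex_banach_algebra_1"
  assumes "s \<in> halfplane"
  shows "norm (scaleC (of_nat n powr (- s)) (c n)) \<le> norm (c n)"
  using norm_powr_halfplane_le[OF assms, of n]
  by (simp add: norm_scaleC mult_left_le_one_le)

lemma summable_dser_term:
  fixes a :: "'a::comm_complex_banach_algebra_1 ell"
  assumes "s \<in> halfplane"
  shows "summable (\<lambda>n. norm (scaleC (of_nat n powr (- s)) (coeff a n)))"
  by (rule summable_comparison_test'[OF summable_norm_coeff[of a]])
     (use norm_dser_term_le[OF assms] in auto)

lemma norm_dser_le:
  fixes a :: "'a::comm_complex_banach_algebra_1 ell"
  assumes "s \<in> halfplane"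
  shows "norm (dser (coeff a) s) \<le> norm a"
proof -
  have "norm (dser (coeff a) s) \<le> (\<Sum>n. norm (scaleC (of_nat n powr (- s)) (coeff a n)))"
    unfolding dser_def by (rule summable_norm[OF summable_dser_term[OF assms]])
  also have "\<dots> \<le> norm a"
    unfolding norm_ell_def
    by (intro suminf_le summable_dser_term summable_norm_coeff norm_dser_term_le assms)
  finally show ?thesis .
qed

lemma bounded_linear_dser:
  assumes "s \<in> halfplane"
  shows "bounded_linear (\<lambda>a :: 'a::comm_complex_banach_algebra_1 ell. dser (coeff a) s)"
proof (rule bounded_linear_intro[of _ 1])
  note sm = summable_norm_cancel[OF summable_dser_term[OF assms]]
  fix a b :: "'a ell" and r :: real
  show "dser (coeff (a + b)) s = dser (coeff a) s + dser (coeff b) s"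
    unfolding dser_def by (subst suminf_add[OF sm sm]) (simp add: scaleC_add_right)
  show "dser (coeff (r *\<^sub>R a)) s = r *\<^sub>R dser (coeff a) s"
    unfolding dser_def by (subst suminf_scaleR_right[OF sm]) (simp add: scaleC_scaleR_right)
qed (use norm_dser_le[OF assms] in auto)

section \<open>Finite support, multiplication by weights, and truncation\<close>

definition finsupp :: "'a::real_normed_vector ell \<Rightarrow> bool" where
  "finsupp a \<longleftrightarrow> finite {n. coeff a n \<noteq> 0}"

text \<open>Junk value unless the weighted sequence is again absolutely summable.\<close>

definition wmul :: "(nat \<Rightarrow> real) \<Rightarrow> 'a::real_normed_vector ell \<Rightarrow> 'a ell" where
  "wmul w a = Ell (\<lambda>n. w n *\<^sub>R coeff a n)"

lemma coeff_wmul_bounded: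
  assumes "\<And>n. \<bar>w n\<bar> \<le> 1"
  shows "coeff (wmul w a) n = w n *\<^sub>R coeff a n"
proof -
  have "summable (\<lambda>n. norm (w n *\<^sub>R coeff a n))"
    by (rule summable_comparison_test'[OF summable_norm_coeff[of a]])
       (use assms in \<open>auto intro: mult_left_le_one_le\<close>)
  then show ?thesis by (simp add: wmul_def Ell_inverse ell1_def)
qed

lemma coeff_wmul_finsupp:
  assumes "finsupp a" shows "coeff (wmul w a) n = w n *\<^sub>R coeff a n"
proof -
  have "summable (\<lambda>n. norm (w n *\<^sub>R coeff a n))"
    by (rule summable_finite[of "{n. coeff a n \<noteq> 0}"]) (use assms in \<open>auto simp: finsupp_def\<close>)
  then show ?thesis by (simp add: wmul_def Ell_inverse ell1_def)
qed

lemma finsupp_wmul: "finsupp a \<Longrightarrow> finsupp (wmul w a)"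
  using coeff_wmul_finsupp[of a w] unfolding finsupp_def by (auto elim: rev_finite_subset)

lemma norm_wmul_le:
  assumes "\<And>n. \<bar>w n\<bar> \<le> 1" shows "norm (wmul w a) \<le> norm a"
  unfolding norm_ell_def
  by (intro suminf_le summable_norm_coeff)
     (use assms in \<open>auto simp: coeff_wmul_bounded intro: mult_left_le_one_le\<close>)

definition trunc :: "nat \<Rightarrow> 'a::real_normed_vector ell \<Rightarrow> 'a ell" where
  "trunc N = wmul (\<lambda>n. if n < N then 1 else 0)"

lemma coeff_trunc: "coeff (trunc N a) n = (if n < N then coeff a n else 0)"
  unfolding trunc_def by (subst coeff_wmul_bounded) auto

lemma finsupp_trunc: "finsupp (trunc N a)"
  unfolding finsupp_def by (rule finite_subset[of _ "{..<N}"]) (auto simp: coeff_trunc)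

text \<open>The distance from \<open>a\<close> to its truncation is exactly a tail of the convergent
  series of norms.\<close>

lemma tendsto_trunc: "(\<lambda>N. trunc N a) \<longlonglongrightarrow> a"
proof -
  have "norm (trunc N a - a) = norm a - (\<Sum>n<N. norm (coeff a n))" for N
  proof -
    have "norm (trunc N a - a) = (\<Sum>n. norm (coeff (trunc N a - a) (n + N))) + (\<Sum>n<N. norm (coeff (trunc N a - a) n))"
      unfolding norm_ell_def by (rule suminf_split_initial_segment) (rule summable_norm_coeff)
    also have "\<dots> = (\<Sum>n. norm (coeff a (n + N)))"
      by (simp add: coeff_trunc)
    also have "\<dots> = norm a - (\<Sum>n<N. norm (coeff a n))"
      unfolding norm_ell_def by (rule suminf_minus_initial_segment) simp
    finally show ?thesis .
  qed
  moreover have "(\<lambda>N. norm a - (\<Sum>n<N. norm (coeff a n))) \<longlonglongrightarrow> norm a - norm a"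
    unfolding norm_ell_def by (intro tendsto_intros summable_LIMSEQ) simp
  ultimately have "(\<lambda>N. norm (trunc N a - a)) \<longlonglongrightarrow> 0" by simp
  then show ?thesis by (simp add: tendsto_norm_zero_iff LIM_zero_iff)
qed

lemma dser_eq_sum:
  assumes "\<And>n. n \<ge> N \<Longrightarrow> c n = 0"
  shows "dser c s = (\<Sum>n<N. scaleC (of_nat n powr (- s)) (c n))"
  unfolding dser_def using assms by (intro suminf_finite) (auto simp: scaleC_zero_right)

text \<open>For truncated sequences everything is a finite sum of \<open>T\<close> over pairs of
  positive indices below \<open>N\<close>. Grouping the pairs by their product gives the series of
  the convolution, since \<open>n powr (- s)\<close> is multiplicative in \<open>n\<close>.\<close>

lemma dser_times_trunc:
  fixes a b :: "'a::comm_complex_banach_algebra_1 ell"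
  shows "dser (coeff (trunc N a * trunc N b)) s = dser (coeff (trunc N a)) s * dser (coeff (trunc N b)) s"
proof -
  define S where "S = (\<lambda>n::nat. {(k, l). k * l = n})"
  have fS: "finite (S n)" if "n > 0" for n using finite_factor_pairs[OF that] by (simp add: S_def)
  define A where "A = coeff (trunc N a)"
  define B where "B = coeff (trunc N b)"
  have A0: "A n = 0" if "n \<ge> N \<or> n = 0" for n using that by (auto simp: A_def coeff_trunc)
  have B0: "B n = 0" if "n \<ge> N \<or> n = 0" for n using that by (auto simp: B_def coeff_trunc)
  define T where "T = (\<lambda>x. scaleC (of_nat (fst x * snd x) powr (- s)) (A (fst x) * B (snd x)))"
  have T0: "T (k, l) = 0" if "k \<ge> N \<or> l \<ge> N \<or> k = 0 \<or> l = 0" for k l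
    using that A0 B0 by (auto simp: T_def scaleC_zero_right)
  \<comment> \<open>No product of two indices below \<open>N\<close> reaches \<open>K\<close>, so
    the convolution vanishes from \<open>K\<close> on.\<close>
  define K where "K = Suc (N * N)"
  have vanish: "dconv A B n = 0" if "n \<ge> K" for n
  proof -
    have "A k * B l = 0" if "k * l = n" for k l
    proof (rule ccontr)
      assume "A k * B l \<noteq> 0"
      then have "A k \<noteq> 0" "B l \<noteq> 0" by auto
      then have "k < N" "l < N" using A0 B0 by (meson not_le)+
      then have "k * l \<le> N * N" by (intro mult_mono) auto
      then show False using \<open>k * l = n\<close> \<open>n \<ge> K\<close> by (simp add: K_def)
    qed
    then show ?thesis unfolding dconv_def by (intro sum.neutral) auto
  qed
  have "dser (coeff (trunc N a * trunc N b)) s = (\<Sum>n<K. scaleC (of_nat n powr (- s)) (dconv A B n))"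
    unfolding coeff_times A_def[symmetric] B_def[symmetric] by (rule dser_eq_sum) (rule vanish)
  also have "\<dots> = (\<Sum>n\<in>{0<..<K}. scaleC (of_nat n powr (- s)) (dconv A B n))"
    by (intro sum.mono_neutral_right) (auto simp: not_less scaleC_zero_right)
  also have "\<dots> = (\<Sum>n\<in>{0<..<K}. \<Sum>x\<in>S n. T x)"
    unfolding dconv_def S_def
    by (intro sum.cong refl) (auto simp: scaleC_sum_right case_prod_unfold T_def intro!: sum.cong)
  also have "\<dots> = (\<Sum>(n, x)\<in>Sigma {0<..<K} S. T x)"
    by (intro sum.Sigma) (auto intro!: fS)
  also have "\<dots> = (\<Sum>x\<in>snd ` Sigma {0<..<K} S. T x)"
    by (subst sum.reindex) (auto simp: inj_on_def S_def case_prod_unfold)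
  also have "\<dots> = (\<Sum>x\<in>{0<..<N} \<times> {0<..<N}. T x)"
  proof (rule sum.mono_neutral_right)
    show "finite (snd ` Sigma {0<..<K} S)" by (intro finite_imageI finite_SigmaI fS) auto
    show "{0<..<N} \<times> {0<..<N} \<subseteq> snd ` Sigma {0<..<K} S"
    proof
      fix x assume "x \<in> {0<..<N} \<times> {0<..<N}"
      then obtain k l where x: "x = (k, l)" "0 < k" "0 < l" "k < N" "l < N" by auto
      then have "k * l \<le> N * N" by (intro mult_mono) auto
      then have "(k * l, x) \<in> Sigma {0<..<K} S" using x by (intro SigmaI) (simp_all add: S_def K_def)
      then show "x \<in> snd ` Sigma {0<..<K} S" by (rule image_eqI[rotated]) simp
    qed
    show "\<forall>x\<in>snd ` Sigma {0<..<K} S - {0<..<N} \<times> {0<..<N}. T x = 0"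
    proof
      fix x assume "x \<in> snd ` Sigma {0<..<K} S - {0<..<N} \<times> {0<..<N}"
      then have "fst x \<ge> N \<or> snd x \<ge> N \<or> fst x = 0 \<or> snd x = 0" by (cases x) auto
      then show "T x = 0" using T0[of "fst x" "snd x"] by simp
    qed
  qed
  also have "\<dots> = (\<Sum>x\<in>{..<N} \<times> {..<N}. T x)"
    by (rule sum.mono_neutral_left) (auto, (metis T0 gr0I)+)
  also have "\<dots> = (\<Sum>k<N. scaleC (of_nat k powr (- s)) (A k)) * (\<Sum>l<N. scaleC (of_nat l powr (- s)) (B l))"
    by (simp add: sum_product sum.cartesian_product case_prod_unfold T_def of_nat_mult_powr
          mult_scaleC_left mult_scaleC_right scaleC_scaleC mult.commute del: of_nat_mult)
  also have "\<dots> = dser (coeff (trunc N a)) s * dser (coeff (trunc N b)) s"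
    unfolding A_def[symmetric] B_def[symmetric]
    by (subst (1 2) dser_eq_sum[of N]) (use A0 B0 in auto)
  finally show ?thesis .
qed

text \<open>The truncated identity passes to the limit, as multiplication and evaluation at
  \<open>s\<close> are continuous in the norm.\<close>

lemma dser_times:
  fixes a b :: "'a::comm_complex_banach_algebra_1 ell"
  assumes "s \<in> halfplane"
  shows "dser (coeff (a * b)) s = dser (coeff a) s * dser (coeff b) s"
proof (rule LIMSEQ_unique)
  note tendsto_dser = bounded_linear.tendsto[OF bounded_linear_dser[OF assms]]
  show "(\<lambda>N. dser (coeff (trunc N a * trunc N b)) s) \<longlonglongrightarrow> dser (coeff (a * b)) s"
    by (intro tendsto_dser tendsto_mult tendsto_trunc)
  show "(\<lambda>N. dser (coeff (trunc N a * trunc N b)) s) \<longlonglongrightarrow> dser (coeff a) s * dser (coeff b) s"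
    unfolding dser_times_trunc by (intro tendsto_dser tendsto_mult tendsto_trunc)
qed

lemma dser_one: "dser (coeff 1) s = (1 :: 'a::comm_complex_banach_algebra_1)"
  by (subst dser_eq_sum[of 2])
     (auto simp: one_ell.rep_eq dunit_def numeral_2_eq_2 scaleC_one scaleC_zero_left scaleC_zero_right)

lemma dser_power:
  fixes a :: "'a::comm_complex_banach_algebra_1 ell"
  assumes "s \<in> halfplane"
  shows "dser (coeff (a ^ k)) s = dser (coeff a) s ^ k"
  by (induction k) (simp_all add: dser_one dser_times assms)

lemma dser_of_nat:
  assumes "s \<in> halfplane"
  shows "dser (coeff (of_nat k)) s = (of_nat k :: 'a::comm_complex_banach_algebra_1)"
proof (induction k)
  case 0
  show ?case by (simp add: dser_def scaleC_zero_right)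
next
  case (Suc k)
  have "dser (coeff (of_nat k + 1)) s = dser (coeff (of_nat k)) s + (dser (coeff 1) s :: 'a)"
    by (rule linear_add[OF bounded_linear.linear[OF bounded_linear_dser[OF assms]]])
  then have "dser (coeff (of_nat k + 1)) s = (of_nat k + 1 :: 'a)"
    by (simp only: Suc dser_one)
  then show ?case by (simp only: of_nat_Suc add.commute)
qed

section \<open>Bounding coefficients by values on the imaginary axis\<close>

lemma tendsto_mean_powers:
  fixes z :: complex
  assumes "cmod z = 1" "z \<noteq> 1"
  shows "(\<lambda>T. (\<Sum>j<T. z ^ j) / of_nat T) \<longlonglongrightarrow> 0"
proof (rule Lim_null_comparison)
  \<comment> \<open>The geometric sums stay bounded independently of \<open>T\<close>, so dividing
    by \<open>T\<close> sends them to 0.\<close>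
  have "cmod (\<Sum>j<T. z ^ j) \<le> 2 / cmod (1 - z)" for T
  proof -
    have "cmod (1 - z ^ T) \<le> 2"
      using norm_triangle_ineq4[of 1 "z ^ T"] by (simp add: norm_power assms)
    then show ?thesis
      using assms(2) by (simp add: sum_gp_strict norm_divide divide_right_mono)
  qed
  then show "\<forall>\<^sub>F T in sequentially. cmod ((\<Sum>j<T. z ^ j) / of_nat T) \<le> (2 / cmod (1 - z)) / real T"
    by (intro always_eventually allI) (simp add: norm_divide divide_right_mono del: divide_divide_eq_left)
  show "(\<lambda>T. (2 / cmod (1 - z)) / real T) \<longlonglongrightarrow> 0"
    by (rule lim_const_over_n)
qed

text \<open>The coefficients of a Dirichlet series are recovered as means along an arithmetic progression
  on the imaginary axis; a step smaller than the relevant \<open>2 * pi / \<bar>ln (n / m)\<bar>\<close>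
  separates \<open>n\<close> from all other \<open>m < N\<close>.\<close>

lemma norm_coeff_le_of_imaginary_axis:
  fixes c :: "'a::comm_complex_banach_algebra_1 ell"
  assumes bound: "\<And>t. norm (dser (coeff c) (\<i> * of_real t)) \<le> B"
  shows "norm (coeff c n) \<le> B"
proof (cases "n = 0")
  case True
  have "0 \<le> B" by (rule order_trans[OF norm_ge_zero bound[of 0]])
  then show ?thesis using True by simp
next
  case False
  show ?thesis
  proof (rule field_le_epsilon)
    fix e :: real assume "e > 0"
    obtain N0 where N0: "\<And>N. N \<ge> N0 \<Longrightarrow> norm (trunc N c - c) < e"
      using metric_LIMSEQ_D[OF tendsto_trunc[of c] \<open>e > 0\<close>] by (auto simp: dist_norm)
    define N where "N = Suc (max N0 n)"
    have N: "norm (c - trunc N c) < e" "n < N"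
      using N0[of N] by (auto simp: N_def norm_minus_commute)
    \<comment> \<open>For positive \<open>m\<close> and \<open>n\<close> below \<open>N\<close> the
      logarithms differ by less than \<open>N\<close>. Hence the angle of \<open>z m\<close> is less
      than 1 in absolute value, and \<open>z m = 1\<close> forces \<open>m = n\<close>.\<close>
    define h where "h = 1 / real N"
    define z where "z = (\<lambda>m. cis (h * (ln (real n) - ln (real m))))"
    have hp: "h > 0" using N by (simp add: h_def)
    have ax: "\<i> * of_real t \<in> halfplane" for t by (simp add: halfplane_def)
    have pw: "of_nat m powr (\<i> * of_real t) = cis (t * ln (real m))" if "m > 0" for m t
      using that by (simp add: powr_def cis_conv_exp mult_ac Ln_of_nat)
    have z1: "z m \<noteq> 1" if "m < N" "m \<noteq> n" "m > 0" for m
    proof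
      assume "z m = 1"
      define x where "x = h * (ln (real n) - ln (real m))"
      have "ln (real n) < real N" "ln (real m) < real N" "ln (real n) \<ge> 0" "ln (real m) \<ge> 0"
        using that False N less_trans[OF ln_less_self, of "real n" "real N"]
          less_trans[OF ln_less_self, of "real m" "real N"] by auto
      then have "\<bar>ln (real n) - ln (real m)\<bar> < real N" by linarith
      then have "\<bar>x\<bar> < 1"
        using N(2) by (simp add: x_def h_def abs_mult divide_simps)
      have "cos x = 1" "sin x = 0" using \<open>z m = 1\<close> by (auto simp: z_def x_def complex_eq_iff)
      then have "x = 0"
        using \<open>\<bar>x\<bar> < 1\<close> cos_one_2pi[of x] sin_zero_abs_cos_one sin_eq_0_pi[of x] pi_gt3 by auto
      then show False using that False hp by (simp add: x_def)
    qed
    define u where "u = (\<lambda>j. \<i> * of_real (real j * h))"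
    \<comment> \<open>Averaging against \<open>n powr (u j)\<close> multiplies the coefficient at
      \<open>m\<close> by the mean of the powers of \<open>z m\<close>. This factor is 1 for
      \<open>m = n\<close> and tends to 0 for every other positive \<open>m\<close> below
      \<open>N\<close>.\<close>
    define mean where "mean = (\<lambda>F :: nat \<Rightarrow> 'a. \<lambda>T. (\<Sum>j<T. scaleC (of_nat n powr (u j)) (F j)) /\<^sub>R real T)"
    have n1: "cmod (of_nat n powr (u j)) = 1" for j
      unfolding u_def using False by (subst pw) auto
    have mean_le: "norm (mean F T) \<le> C" if "\<And>j. norm (F j) \<le> C" "T > 0" for F C T
    proof -
      have "norm (\<Sum>j<T. scaleC (of_nat n powr (u j)) (F j)) \<le> real (card {..<T}) * C"
        by (rule sum_norm_bound) (simp add: norm_scaleC n1 that)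
      then show ?thesis using that(2) by (simp add: mean_def divide_simps mult_ac)
    qed
    have diff: "mean (\<lambda>j. F j - G j) T = mean F T - mean G T" for F G T
      by (simp add: mean_def bounded_bilinear.diff_right[OF bounded_bilinear_scaleC] sum_subtractf scaleR_diff_right)
    define P where "P = (\<lambda>T. mean (\<lambda>j. dser (coeff (trunc N c)) (u j)) T)"
    have "P T = (\<Sum>m<N. scaleC ((\<Sum>j<T. z m ^ j) / of_nat T) (coeff c m))" if "T > 0" for T
    proof -
      have "P T = (\<Sum>j<T. \<Sum>m<N. scaleC (of_nat n powr (u j) * of_nat m powr (- u j)) (coeff c m)) /\<^sub>R real T"
        unfolding P_def mean_def
        by (subst dser_eq_sum[of N]) (auto simp: coeff_trunc scaleC_sum_right scaleC_scaleC)
      also have "(\<Sum>j<T. \<Sum>m<N. scaleC (of_nat n powr (u j) * of_nat m powr (- u j)) (coeff c m))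
          = (\<Sum>j<T. \<Sum>m<N. scaleC (z m ^ j) (coeff c m))"
      proof (intro sum.cong refl)
        fix j m
        show "scaleC (of_nat n powr (u j) * of_nat m powr (- u j)) (coeff c m) = scaleC (z m ^ j) (coeff c m)"
        proof (cases "m = 0")
          case m: False
          have "of_nat m powr (- u j) = cis (- (real j * h) * ln (real m))"
            using pw[of m "- (real j * h)"] m by (simp add: u_def)
          moreover have "of_nat n powr (u j) = cis (real j * h * ln (real n))"
            using pw[of n "real j * h"] False by (simp add: u_def)
          moreover have "z m ^ j = cis (real j * h * ln (real n) + - (real j * h) * ln (real m))"
            unfolding z_def by (subst Complex.DeMoivre) (simp add: algebra_simps)
          ultimately have "of_nat n powr (u j) * of_nat m powr (- u j) = z m ^ j"
            by (simp only: cis_mult)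
          then show ?thesis by simp
        qed (simp add: scaleC_zero_right)
      qed
      also have "\<dots> = (\<Sum>m<N. scaleC (\<Sum>j<T. z m ^ j) (coeff c m))"
        by (subst sum.swap) (simp add: scaleC_sum_left)
      finally show ?thesis
        by (simp add: scaleC_sum_right scaleC_scaleC divide_inverse mult_ac flip: scaleC_of_real)
    qed
    then have evP: "\<forall>\<^sub>F T in sequentially. (\<Sum>m<N. scaleC ((\<Sum>j<T. z m ^ j) / of_nat T) (coeff c m)) = P T"
      by (intro eventually_mono[OF eventually_gt_at_top[of 0]]) simp
    have lim: "(\<lambda>T. \<Sum>m<N. scaleC ((\<Sum>j<T. z m ^ j) / of_nat T) (coeff c m))
        \<longlonglongrightarrow> (\<Sum>m<N. scaleC (if m = n then 1 else 0) (coeff c m))"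
    proof (intro tendsto_sum)
      fix m assume "m \<in> {..<N}"
      consider "m = 0" | "m = n" | "m > 0" "m \<noteq> n" by blast
      then show "(\<lambda>T. scaleC ((\<Sum>j<T. z m ^ j) / of_nat T) (coeff c m))
          \<longlonglongrightarrow> scaleC (if m = n then 1 else 0) (coeff c m)"
      proof cases
        case 1
        then show ?thesis by (simp add: scaleC_zero_right)
      next
        case 2
        have "\<forall>\<^sub>F T in sequentially. 1 = (\<Sum>j<T. z m ^ j) / of_nat T"
          by (intro eventually_mono[OF eventually_gt_at_top[of 0]]) (simp add: z_def 2)
        then have "(\<lambda>T. (\<Sum>j<T. z m ^ j) / of_nat T) \<longlonglongrightarrow> 1"
          by (rule Lim_transform_eventually[OF tendsto_const])
        then show ?thesis
          using 2 by (intro bounded_bilinear.tendsto[OF bounded_bilinear_scaleC]) auto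
      next
        case 3
        then have "(\<lambda>T. (\<Sum>j<T. z m ^ j) / of_nat T) \<longlonglongrightarrow> 0"
          using \<open>m \<in> {..<N}\<close> by (intro tendsto_mean_powers z1) (auto simp: z_def)
        then show ?thesis
          using 3 by (intro bounded_bilinear.tendsto[OF bounded_bilinear_scaleC]) auto
      qed
    qed
    have "(\<Sum>m<N. scaleC (if m = n then 1 else 0) (coeff c m)) = coeff c n"
      using N(2) by (subst sum.remove[of _ n]) (auto simp: scaleC_one scaleC_zero_left)
    then have "P \<longlonglongrightarrow> coeff c n"
      using Lim_transform_eventually[OF lim evP] by simp
    then have "(\<lambda>T. norm (P T)) \<longlonglongrightarrow> norm (coeff c n)" by (rule tendsto_norm)
    moreover have "norm (P T) \<le> B + e" if "T > 0" for T
    proof -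
      \<comment> \<open>Passing from \<open>c\<close> to its truncation costs at most
        \<open>e\<close> at every sample point, and \<open>mean\<close> preserves a uniform
        bound.\<close>
      have "P T = mean (\<lambda>j. dser (coeff c) (u j)) T - mean (\<lambda>j. dser (coeff (c - trunc N c)) (u j)) T"
        unfolding diff[symmetric] P_def
        by (simp only: linear_diff[OF bounded_linear.linear[OF bounded_linear_dser[OF ax]], folded u_def] u_def) simp
      moreover have "norm (mean (\<lambda>j. dser (coeff c) (u j)) T) \<le> B"
        using bound that unfolding u_def by (intro mean_le)
      moreover have "norm (mean (\<lambda>j. dser (coeff (c - trunc N c)) (u j)) T) \<le> e"
      proof (rule mean_le[OF _ that])
        fix j show "norm (dser (coeff (c - trunc N c)) (u j)) \<le> e"
          using N(1) norm_dser_le[OF ax, of "c - trunc N c" "real j * h"] unfolding u_def by linarith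
      qed
      ultimately show ?thesis
        by (smt (verit) norm_triangle_ineq4)
    qed
    ultimately show "norm (coeff c n) \<le> B + e"
      by (intro LIMSEQ_le_const2) (auto intro!: exI[of _ 1])
  qed
qed

section \<open>Derivations and powers of an inverse\<close>

definition additive_weight :: "(nat \<Rightarrow> real) \<Rightarrow> bool" where
  "additive_weight v \<longleftrightarrow> (\<forall>m n. m > 0 \<longrightarrow> n > 0 \<longrightarrow> v (m * n) = v m + v n)"

lemma additive_weight_1: "additive_weight v \<Longrightarrow> v 1 = 0"
  by (metis additive_weight_def add_cancel_left_left mult_1 zero_less_one)

lemma additive_weight_multiplicity:
  fixes p :: nat
  assumes "prime p" shows "additive_weight (\<lambda>n. real (multiplicity p n))"
  using assms unfolding additive_weight_def
  by (auto simp: prime_elem_multiplicity_mult_distrib)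

text \<open>On each factor pair of \<open>n\<close> the weight splits as \<open>v k + v l\<close>,
  which is the Leibniz rule term by term.\<close>

lemma dconv_derivation:
  fixes a b :: "nat \<Rightarrow> 'a::{comm_ring_1, real_normed_algebra_1}"
  assumes "additive_weight v"
  shows "v n *\<^sub>R dconv a b n = dconv (\<lambda>n. v n *\<^sub>R a n) b n + dconv a (\<lambda>n. v n *\<^sub>R b n) n"
proof (cases "n = 0")
  case False
  have "v n *\<^sub>R dconv a b n = (\<Sum>(k, l)\<in>{(k, l). k * l = n}. v n *\<^sub>R (a k * b l))"
    unfolding dconv_def by (simp add: scaleR_sum_right case_prod_unfold)
  also have "\<dots> = (\<Sum>(k, l)\<in>{(k, l). k * l = n}. v k *\<^sub>R a k * b l + a k * v l *\<^sub>R b l)"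
  proof (intro sum.cong refl, clarify)
    fix k l assume "n = k * l"
    then have "v (k * l) = v k + v l" using assms False by (simp add: additive_weight_def)
    then show "v (k * l) *\<^sub>R (a k * b l) = v k *\<^sub>R a k * b l + a k * v l *\<^sub>R b l"
      by (simp add: scaleR_add_left)
  qed
  also have "\<dots> = dconv (\<lambda>n. v n *\<^sub>R a n) b n + dconv a (\<lambda>n. v n *\<^sub>R b n) n"
    unfolding dconv_def by (simp add: case_prod_unfold sum.distrib)
  finally show ?thesis .
qed simp

text \<open>A relation instead of an operator: the weighted sequence of an element of
  \<open>ell1\<close> may fail to be summable, so the existence of the derivative has to be shown in
  each case.\<close>

definition derives :: "(nat \<Rightarrow> real) \<Rightarrow> 'a::real_normed_vector ell \<Rightarrow> 'a ell \<Rightarrow> bool" where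
  "derives v a a' \<longleftrightarrow> (\<forall>n. coeff a' n = v n *\<^sub>R coeff a n)"

lemma derives_times:
  fixes a b :: "'a::{comm_ring_1, real_normed_algebra_1} ell"
  assumes "additive_weight v" "derives v a a'" "derives v b b'"
  shows "derives v (a * b) (a' * b + a * b')"
  unfolding derives_def
proof
  fix n
  have "coeff a' = (\<lambda>n. v n *\<^sub>R coeff a n)" "coeff b' = (\<lambda>n. v n *\<^sub>R coeff b n)"
    using assms(2,3) by (auto simp: derives_def fun_eq_iff)
  then show "coeff (a' * b + a * b') n = v n *\<^sub>R coeff (a * b) n"
    by (simp add: coeff_times dconv_derivation[OF assms(1)])
qed

text \<open>The derivative of \<open>q\<close> is a priori only a formal Dirichlet series, hence the computation
  with coefficient functions.\<close>

lemma derives_inverse: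
  fixes p q :: "'a::{comm_ring_1, real_normed_algebra_1} ell"
  assumes v: "additive_weight v" and p': "derives v p p'" and pq: "p * q = 1"
  shows "derives v q (- (q * q * p'))"
proof -
  define e where "e = (\<lambda>n. v n *\<^sub>R coeff q n)"
  have "dconv (coeff p) e = coeff (- (p' * q))"
  proof
    fix n
    have "coeff p' = (\<lambda>n. v n *\<^sub>R coeff p n)" using p' by (auto simp: derives_def fun_eq_iff)
    then have "coeff (p' * q) n + dconv (coeff p) e n = v n *\<^sub>R coeff (p * q) n"
      by (simp add: coeff_times dconv_derivation[OF v] e_def)
    also have "\<dots> = 0"
      using additive_weight_1[OF v] by (simp add: pq one_ell.rep_eq dunit_def)
    finally show "dconv (coeff p) e n = coeff (- (p' * q)) n"
      by (simp add: eq_neg_iff_add_eq_0 add.commute)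
  qed
  \<comment> \<open>Associativity of \<open>dconv\<close> holds for arbitrary coefficient functions,
    so multiplication by \<open>q\<close> recovers \<open>e\<close> and exhibits it as an element of
    \<open>ell1\<close>.\<close>
  moreover have "dconv (coeff q) (dconv (coeff p) e) = e"
  proof -
    have "dconv (coeff q) (coeff p) = dunit"
      using pq by (metis coeff_times mult.commute one_ell.rep_eq)
    then show ?thesis
      by (simp add: dconv_unit_left e_def flip: dconv_assoc)
  qed
  ultimately have "e = coeff (q * - (p' * q))" by (simp only: coeff_times[of q "- (p' * q)"])
  moreover have "q * - (p' * q) = - (q * q * p')" by (simp add: algebra_simps)
  ultimately have "e = coeff (- (q * q * p'))" by (simp only:)
  then show ?thesis unfolding derives_def e_def by metis
qed

text \<open>This is the power rule combined with \<open>derives_inverse\<close>. Only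
  \<open>p\<close> is differentiated on the right, which keeps the derivatives of powers of
  \<open>q\<close> within reach of bounds on powers of \<open>q\<close>.\<close>

lemma derives_inverse_power:
  fixes p q :: "'a::{comm_ring_1, real_normed_algebra_1} ell"
  assumes "additive_weight v" "derives v p p'" "p * q = 1"
  shows "derives v (q ^ m) (- (of_nat m * q ^ Suc m * p'))"
proof (induction m)
  case 0
  show ?case using additive_weight_1[OF assms(1)] by (simp add: derives_def one_ell.rep_eq dunit_def)
next
  case (Suc m)
  have "derives v (q * q ^ m) (- (q * q * p') * q ^ m + q * - (of_nat m * q ^ Suc m * p'))"
    by (intro derives_times derives_inverse[OF assms] assms(1) Suc)
  also have "- (q * q * p') * q ^ m + q * - (of_nat m * q ^ Suc m * p') = - (of_nat (Suc m) * q ^ Suc (Suc m) * p')"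
    by (simp add: algebra_simps)
  finally show ?case by simp
qed

section \<open>Twists by real powers\<close>

definition twist :: "real \<Rightarrow> 'a::real_normed_vector ell \<Rightarrow> 'a ell" where
  "twist \<sigma> = wmul (\<lambda>n. real n powr (- \<sigma>))"

lemma coeff_twist:
  assumes "\<sigma> \<ge> 0"
  shows "coeff (twist \<sigma> a) n = (real n powr (- \<sigma>)) *\<^sub>R coeff a n"
  unfolding twist_def
proof (rule coeff_wmul_bounded)
  fix n show "\<bar>real n powr - \<sigma>\<bar> \<le> 1"
    using powr_mono[of "- \<sigma>" 0 "real n"] assms by (cases "n = 0") auto
qed

lemma norm_twist_le: "\<sigma> \<ge> 0 \<Longrightarrow> norm (twist \<sigma> a) \<le> norm a"
proof -
  assume "\<sigma> \<ge> 0"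
  then have "\<bar>real n powr - \<sigma>\<bar> \<le> 1" for n
    using powr_mono[of "- \<sigma>" 0 "real n"] by (cases "n = 0") auto
  then show ?thesis unfolding twist_def by (rule norm_wmul_le)
qed

lemma twist_0: "twist 0 a = a"
  by (rule ell_eqI) (simp add: coeff_twist)

lemma twist_times:
  fixes a b :: "'a::{comm_ring_1, real_normed_algebra_1} ell"
  assumes "\<sigma> \<ge> 0"
  shows "twist \<sigma> (a * b) = twist \<sigma> a * twist \<sigma> b"
proof (rule ell_eqI)
  fix n
  have "coeff (twist \<sigma> (a * b)) n = (\<Sum>(k, l)\<in>{(k, l). k * l = n}. (real n powr (- \<sigma>)) *\<^sub>R (coeff a k * coeff b l))"
    by (simp add: coeff_twist assms coeff_times dconv_def scaleR_sum_right case_prod_unfold)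
  also have "\<dots> = (\<Sum>(k, l)\<in>{(k, l). k * l = n}. (real k powr (- \<sigma>)) *\<^sub>R coeff a k * (real l powr (- \<sigma>)) *\<^sub>R coeff b l)"
    by (intro sum.cong refl) (auto simp: powr_mult mult.commute)
  also have "\<dots> = coeff (twist \<sigma> a * twist \<sigma> b) n"
    by (simp add: coeff_times dconv_def coeff_twist assms)
  finally show "coeff (twist \<sigma> (a * b)) n = coeff (twist \<sigma> a * twist \<sigma> b) n" .
qed

text \<open>A twist shifts the argument to the right. For \<open>\<sigma> \<ge> 0\<close> the shift
  maps \<open>halfplane\<close> into itself, so a bound on pointwise inverses is inherited by all
  twists.\<close>

lemma dser_twist:
  assumes "\<sigma> \<ge> 0"
  shows "dser (coeff (twist \<sigma> a)) s = dser (coeff a) (s + of_real \<sigma>)"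
proof -
  have "scaleC (of_nat n powr - s) (coeff (twist \<sigma> a) n) = scaleC (of_nat n powr - (s + of_real \<sigma>)) (coeff a n)" for n
  proof -
    have "of_nat n powr - (s + of_real \<sigma>) = of_nat n powr - s * of_real (real n powr - \<sigma>)"
      using powr_add[of "of_nat n :: complex" "- s" "- of_real \<sigma>"] powr_of_real[of "real n" "- \<sigma>"] by simp
    then show ?thesis by (simp add: coeff_twist assms scaleC_scaleC flip: scaleC_of_real)
  qed
  then show ?thesis by (simp add: dser_def)
qed

lemma derives_wmul_twist:
  assumes "\<sigma> \<ge> 0" "finsupp g"
  shows "derives v (twist \<sigma> g) (twist \<sigma> (wmul v g))"
  by (simp add: derives_def coeff_twist coeff_wmul_finsupp assms)

lemma finsupp_times:
  fixes a b :: "'a::{comm_ring_1, real_normed_algebra_1} ell"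
  assumes "finsupp a" "finsupp b" shows "finsupp (a * b)"
  unfolding finsupp_def
proof (rule finite_subset)
  show "finite ((\<lambda>(k, l). k * l) ` ({n. coeff a n \<noteq> 0} \<times> {n. coeff b n \<noteq> 0}))"
    using assms unfolding finsupp_def by (intro finite_imageI finite_cartesian_product)
  show "{n. coeff (a * b) n \<noteq> 0} \<subseteq> (\<lambda>(k, l). k * l) ` ({n. coeff a n \<noteq> 0} \<times> {n. coeff b n \<noteq> 0})"
  proof
    fix n assume "n \<in> {n. coeff (a * b) n \<noteq> 0}"
    then have "(\<Sum>(k, l)\<in>{(k, l). k * l = n}. coeff a k * coeff b l) \<noteq> 0"
      by (simp add: coeff_times dconv_def)
    then obtain x where "x \<in> {(k, l). k * l = n}" "(\<lambda>(k, l). coeff a k * coeff b l) x \<noteq> 0"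
      by (rule sum.not_neutral_contains_not_neutral)
    then show "n \<in> (\<lambda>(k, l). k * l) ` ({n. coeff a n \<noteq> 0} \<times> {n. coeff b n \<noteq> 0})"
      by (intro image_eqI[of _ _ x]) auto
  qed
qed

section \<open>Uniform estimates for powers of inverses of twists\<close>

definition bounded_inverse :: "'a::comm_complex_banach_algebra_1 ell \<Rightarrow> real \<Rightarrow> bool" where
  "bounded_inverse a M \<longleftrightarrow> (\<forall>s\<in>halfplane. \<exists>y. dser (coeff a) s * y = 1 \<and> norm y \<le> M)"

text \<open>The parameters \<open>i\<close>, \<open>j\<close> and \<open>g\<close> make the class of
  estimated elements closed under derivations; the case \<open>i = j = 0\<close>,
  \<open>g = 1\<close> is the one finally applied. It is essential that \<open>C\<close> and
  \<open>J\<close> are chosen before \<open>\<sigma>\<close>, \<open>q\<close>, \<open>k\<close> and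
  \<open>n\<close>.\<close>

definition power_estimate :: "'a::comm_complex_banach_algebra_1 ell \<Rightarrow> real \<Rightarrow> (nat \<Rightarrow> real) \<Rightarrow> bool" where
  "power_estimate p M w \<longleftrightarrow> (\<forall>i j g. finsupp g \<longrightarrow> (\<exists>C J. C \<ge> 0 \<and> (\<forall>\<sigma>\<ge>0. \<forall>q. twist \<sigma> p * q = 1 \<longrightarrow>
     (\<forall>k n. w n * norm (coeff (of_nat k ^ i * q ^ (k + j) * twist \<sigma> g) n) \<le> C * real (k + 1) ^ J * M ^ k))))"

text \<open>Inverses in the coefficient algebra are unique, so the value of \<open>q\<close> is the
  inverse bounded by \<open>M\<close> at the shifted point.\<close>

lemma norm_dser_inverse_le:
  assumes b: "bounded_inverse p M" and "\<sigma> \<ge> 0" "twist \<sigma> p * q = 1"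
  shows "norm (dser (coeff q) (\<i> * of_real t)) \<le> M"
proof -
  define s where "s = \<i> * complex_of_real t"
  have s: "s \<in> halfplane" "s + of_real \<sigma> \<in> halfplane"
    using assms(2) by (auto simp: halfplane_def s_def)
  obtain y where y: "dser (coeff p) (s + of_real \<sigma>) * y = 1" "norm y \<le> M"
    using b s unfolding bounded_inverse_def by blast
  have "dser (coeff p) (s + of_real \<sigma>) * dser (coeff q) s = 1"
    using assms(2,3) dser_times[OF s(1), of "twist \<sigma> p" q] by (simp add: dser_twist dser_one)
  then have "dser (coeff q) s = y"
    using y(1) by (metis mult.assoc mult.commute mult_1)
  then show ?thesis using y(2) by (simp add: s_def)
qed

text \<open>Base case: on the imaginary axis the series is at most
  \<open>real (k + 1) ^ i * M ^ (k + j) * norm g\<close>, and such a bound carries over to each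
  coefficient.\<close>

lemma power_estimate_1:
  assumes b: "bounded_inverse p M"
  shows "power_estimate p M (\<lambda>_. 1)"
  unfolding power_estimate_def
proof (intro allI impI)
  fix i j :: nat and g :: "'a ell" assume g: "finsupp g"
  have M: "M \<ge> 0"
    using b unfolding bounded_inverse_def halfplane_def
    by (metis (mono_tags, lifting) mem_Collect_eq norm_ge_zero order_trans zero_complex.simps(1) order_refl)
  show "\<exists>C J. C \<ge> 0 \<and> (\<forall>\<sigma>\<ge>0. \<forall>q. twist \<sigma> p * q = 1 \<longrightarrow>
     (\<forall>k n. 1 * norm (coeff (of_nat k ^ i * q ^ (k + j) * twist \<sigma> g) n) \<le> C * real (k + 1) ^ J * M ^ k))"
  proof (intro exI[of _ "M ^ j * norm g"] exI[of _ i] conjI allI impI)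
    fix \<sigma> q k n assume \<sigma>: "0 \<le> \<sigma>" and q: "twist \<sigma> p * q = 1"
    have "norm (coeff (of_nat k ^ i * q ^ (k + j) * twist \<sigma> g) n) \<le> real (k + 1) ^ i * M ^ (k + j) * norm g"
    proof (rule norm_coeff_le_of_imaginary_axis)
      fix t
      define s where "s = \<i> * complex_of_real t"
      have s: "s \<in> halfplane" by (auto simp: halfplane_def s_def)
      have "norm (dser (coeff (of_nat k ^ i * q ^ (k + j) * twist \<sigma> g)) s)
          = norm (of_nat k ^ i * dser (coeff q) s ^ (k + j) * dser (coeff (twist \<sigma> g)) s)"
        by (simp add: dser_times dser_power dser_of_nat s)
      also have "\<dots> \<le> norm (of_nat k ^ i :: 'a) * norm (dser (coeff q) s ^ (k + j)) * norm (dser (coeff (twist \<sigma> g)) s)"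
        by (intro order_trans[OF norm_mult_ineq] mult_right_mono norm_mult_ineq norm_ge_zero)
      also have "\<dots> \<le> real (k + 1) ^ i * M ^ (k + j) * norm g"
      proof (intro mult_mono)
        show "norm (of_nat k ^ i :: 'a) \<le> real (k + 1) ^ i"
          using norm_power_ineq[of "of_nat k :: 'a" i]
          by (rule order_trans) (intro power_mono, auto)
        show "norm (dser (coeff q) s ^ (k + j)) \<le> M ^ (k + j)"
          using norm_dser_inverse_le[OF b \<sigma> q, of t]
          by (intro order_trans[OF norm_power_ineq] power_mono) (auto simp: s_def)
        show "norm (dser (coeff (twist \<sigma> g)) s) \<le> norm g"
          using norm_dser_le[OF s] norm_twist_le[OF \<sigma>] by (rule order_trans)
      qed (use M in auto)
      finally show "norm (dser (coeff (of_nat k ^ i * q ^ (k + j) * twist \<sigma> g)) (\<i> * of_real t))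
          \<le> real (k + 1) ^ i * M ^ (k + j) * norm g" by (simp add: s_def)
    qed
    then show "1 * norm (coeff (of_nat k ^ i * q ^ (k + j) * twist \<sigma> g) n) \<le> M ^ j * norm g * real (k + 1) ^ i * M ^ k"
      by (simp add: power_add mult_ac)
  qed (use M in auto)
qed

text \<open>Multiplying the \<open>n\<close>-th coefficient of \<open>X = k ^ i * q ^ (k + j) * g\<close> by \<open>1 + v n\<close> gives
  \<open>X + D X\<close> for the derivation \<open>D\<close> with weight \<open>v\<close>, which is a sum of terms of the same shape.\<close>

lemma power_estimate_step:
  assumes v: "additive_weight v" "\<And>n. v n \<ge> 0" and w: "\<And>n. w n \<ge> 0"
    and p: "finsupp p" and M: "M \<ge> 0" and est: "power_estimate p M w"
  shows "power_estimate p M (\<lambda>n. w n * (1 + v n))"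
  unfolding power_estimate_def
proof (intro allI impI)
  fix i j :: nat and g :: "'a ell" assume g: "finsupp g"
  define g' where "g' = wmul v g"
  define p' where "p' = wmul v p"
  have fin: "finsupp g'" "finsupp p'" "finsupp (p' * g)"
    unfolding g'_def p'_def by (intro finsupp_wmul finsupp_times g p)+
  define X where "X = (\<lambda>\<sigma> q k i j (g :: 'a ell). of_nat k ^ i * q ^ (k + j) * twist \<sigma> g)"
  have est': "\<exists>C J. C \<ge> 0 \<and> (\<forall>\<sigma>\<ge>0. \<forall>q. twist \<sigma> p * q = 1 \<longrightarrow>
      (\<forall>k n. w n * norm (coeff (X \<sigma> q k i j g) n) \<le> C * real (k + 1) ^ J * M ^ k))" if "finsupp g" for i j g
    using est that unfolding power_estimate_def X_def by blast
  obtain C1 J1 where 1: "C1 \<ge> 0" "\<And>\<sigma> q k n. \<sigma> \<ge> 0 \<Longrightarrow> twist \<sigma> p * q = 1 \<Longrightarrow>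
      w n * norm (coeff (X \<sigma> q k i j g) n) \<le> C1 * real (k + 1) ^ J1 * M ^ k" using est'[OF g] by metis
  obtain C2 J2 where 2: "C2 \<ge> 0" "\<And>\<sigma> q k n. \<sigma> \<ge> 0 \<Longrightarrow> twist \<sigma> p * q = 1 \<Longrightarrow>
      w n * norm (coeff (X \<sigma> q k i j g') n) \<le> C2 * real (k + 1) ^ J2 * M ^ k" using est'[OF fin(1)] by metis
  obtain C3 J3 where 3: "C3 \<ge> 0" "\<And>\<sigma> q k n. \<sigma> \<ge> 0 \<Longrightarrow> twist \<sigma> p * q = 1 \<Longrightarrow>
      w n * norm (coeff (X \<sigma> q k (Suc i) (Suc j) (p' * g)) n) \<le> C3 * real (k + 1) ^ J3 * M ^ k" using est'[OF fin(3)] by metis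
  obtain C4 J4 where 4: "C4 \<ge> 0" "\<And>\<sigma> q k n. \<sigma> \<ge> 0 \<Longrightarrow> twist \<sigma> p * q = 1 \<Longrightarrow>
      w n * norm (coeff (X \<sigma> q k i (Suc j) (p' * g)) n) \<le> C4 * real (k + 1) ^ J4 * M ^ k" using est'[OF fin(3)] by metis
  show "\<exists>C J. C \<ge> 0 \<and> (\<forall>\<sigma>\<ge>0. \<forall>q. twist \<sigma> p * q = 1 \<longrightarrow>
     (\<forall>k n. w n * (1 + v n) * norm (coeff (of_nat k ^ i * q ^ (k + j) * twist \<sigma> g) n) \<le> C * real (k + 1) ^ J * M ^ k))"
  proof (intro exI[of _ "C1 + C2 + C3 + real j * C4"] exI[of _ "J1 + J2 + J3 + J4"] conjI allI impI)
    fix \<sigma> q k n assume \<sigma>: "0 \<le> \<sigma>" and q: "twist \<sigma> p * q = 1"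
    \<comment> \<open>Since \<open>k + 1\<close> is at least 1 even for \<open>k = 0\<close>, the
      four exponents can all be raised to their sum.\<close>
    have up: "C * real (k + 1) ^ J * M ^ k \<le> C * real (k + 1) ^ (J1 + J2 + J3 + J4) * M ^ k"
      if "C \<ge> 0" "J \<le> J1 + J2 + J3 + J4" for C J
      using that M by (intro mult_right_mono mult_left_mono power_increasing) auto
    have "derives v (q ^ (k + j) * twist \<sigma> g)
        (- (of_nat (k + j) * q ^ Suc (k + j) * twist \<sigma> p') * twist \<sigma> g + q ^ (k + j) * twist \<sigma> g')"
      unfolding g'_def p'_def
      by (intro derives_times v derives_inverse_power[OF _ derives_wmul_twist q] derives_wmul_twist \<sigma> g p)
    then have D: "v n *\<^sub>R coeff (q ^ (k + j) * twist \<sigma> g) n = coeff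
        (- (of_nat (k + j) * q ^ Suc (k + j) * twist \<sigma> p') * twist \<sigma> g + q ^ (k + j) * twist \<sigma> g') n"
      by (simp add: derives_def)
    have nat: "of_nat m ^ i * a = real m ^ i *\<^sub>R a" "of_nat m * a = real m *\<^sub>R a" for m i and a :: "'a ell"
      by (simp_all add: scaleR_conv_of_real)
    \<comment> \<open>Differentiating \<open>q ^ (k + j)\<close> produces the factor
      \<open>k + j\<close>. Its summand \<open>k\<close> is absorbed by raising \<open>i\<close>,
      while \<open>j\<close> stays as a constant factor; this gives the last two terms.\<close>
    have DX: "v n *\<^sub>R coeff (X \<sigma> q k i j g) n
        = coeff (X \<sigma> q k i j g' - X \<sigma> q k (Suc i) (Suc j) (p' * g) - of_nat j * X \<sigma> q k i (Suc j) (p' * g)) n"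
    proof -
      have "v n *\<^sub>R coeff (X \<sigma> q k i j g) n = real k ^ i *\<^sub>R (v n *\<^sub>R coeff (q ^ (k + j) * twist \<sigma> g) n)"
        by (simp add: X_def mult.assoc nat(1))
      also have "\<dots> = coeff (of_nat k ^ i * (- (of_nat (k + j) * q ^ Suc (k + j) * twist \<sigma> p') * twist \<sigma> g + q ^ (k + j) * twist \<sigma> g')) n"
        unfolding D nat(1) coeff_scaleR ..
      also have "of_nat k ^ i * (- (of_nat (k + j) * q ^ Suc (k + j) * twist \<sigma> p') * twist \<sigma> g + q ^ (k + j) * twist \<sigma> g')
          = X \<sigma> q k i j g' - X \<sigma> q k (Suc i) (Suc j) (p' * g) - of_nat j * X \<sigma> q k i (Suc j) (p' * g)"
        unfolding X_def twist_times[OF \<sigma>] by (simp add: algebra_simps)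
      finally show ?thesis .
    qed
    define x where "x = norm (coeff (X \<sigma> q k i j g) n)"
    have "v n * x = norm (v n *\<^sub>R coeff (X \<sigma> q k i j g) n)" using v(2) by (simp add: x_def)
    also have "\<dots> \<le> norm (coeff (X \<sigma> q k i j g') n) + norm (coeff (X \<sigma> q k (Suc i) (Suc j) (p' * g)) n)
        + real j * norm (coeff (X \<sigma> q k i (Suc j) (p' * g)) n)"
      unfolding DX coeff_diff nat(2) coeff_scaleR
      by (intro order_trans[OF norm_triangle_ineq4] add_mono) auto
    finally have "w n * (v n * x) \<le> w n * (norm (coeff (X \<sigma> q k i j g') n) + norm (coeff (X \<sigma> q k (Suc i) (Suc j) (p' * g)) n)
        + real j * norm (coeff (X \<sigma> q k i (Suc j) (p' * g)) n))"
      using w by (intro mult_left_mono)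
    then have "w n * (1 + v n) * x \<le> w n * x + w n * norm (coeff (X \<sigma> q k i j g') n)
        + w n * norm (coeff (X \<sigma> q k (Suc i) (Suc j) (p' * g)) n) + real j * (w n * norm (coeff (X \<sigma> q k i (Suc j) (p' * g)) n))"
      by (simp add: algebra_simps)
    also have "\<dots> \<le> C1 * real (k + 1) ^ J1 * M ^ k + C2 * real (k + 1) ^ J2 * M ^ k
        + C3 * real (k + 1) ^ J3 * M ^ k + real j * (C4 * real (k + 1) ^ J4 * M ^ k)"
      unfolding x_def using 1(2)[OF \<sigma> q] 2(2)[OF \<sigma> q] 3(2)[OF \<sigma> q] 4(2)[OF \<sigma> q]
      by (intro add_mono mult_left_mono) auto
    also have "\<dots> \<le> C1 * real (k + 1) ^ (J1 + J2 + J3 + J4) * M ^ k + C2 * real (k + 1) ^ (J1 + J2 + J3 + J4) * M ^ k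
        + C3 * real (k + 1) ^ (J1 + J2 + J3 + J4) * M ^ k + real j * (C4 * real (k + 1) ^ (J1 + J2 + J3 + J4) * M ^ k)"
      using 1(1) 2(1) 3(1) 4(1) by (intro add_mono mult_left_mono up) auto
    finally show "w n * (1 + v n) * norm (coeff (of_nat k ^ i * q ^ (k + j) * twist \<sigma> g) n)
        \<le> (C1 + C2 + C3 + real j * C4) * real (k + 1) ^ (J1 + J2 + J3 + J4) * M ^ k"
      by (simp add: x_def X_def algebra_simps)
  qed (use 1(1) 2(1) 3(1) 4(1) in auto)
qed

text \<open>Each prime in \<open>S\<close> is used for two derivation steps. The resulting squares
  make the reciprocal weights summable over the exponents.\<close>

lemma power_estimate_prod:
  assumes b: "bounded_inverse p M" and p: "finsupp p" and M: "M \<ge> 0" and S: "finite S" "\<forall>r\<in>S. prime r"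
  shows "power_estimate p M (\<lambda>n. \<Prod>r\<in>S. (1 + real (multiplicity r n))\<^sup>2)"
  using S
proof (induction S rule: finite_induct)
  case empty
  show ?case using power_estimate_1[OF b] by simp
next
  case (insert r S)
  define w where "w = (\<lambda>n. \<Prod>r\<in>S. (1 + real (multiplicity r n))\<^sup>2)"
  define v where "v = (\<lambda>n. real (multiplicity r n))"
  have w: "w n \<ge> 0" for n unfolding w_def by (intro prod_nonneg) auto
  have v: "additive_weight v" "\<And>n. v n \<ge> 0"
    using insert.prems unfolding v_def by (auto intro: additive_weight_multiplicity)
  have "power_estimate p M (\<lambda>n. w n * (1 + v n) * (1 + v n))"
    using insert.IH insert.prems w v p M by (intro power_estimate_step) (auto simp: w_def)
  then show ?case
    using insert.hyps by (simp add: w_def v_def power2_eq_square mult_ac)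
qed

text \<open>The sharper bound \<open>2 - 1 / (1 + real K)\<close> is what goes through the
  induction, by telescoping.\<close>

lemma sum_inverse_squares_le: "(\<Sum>j\<le>K. 1 / (1 + real j)\<^sup>2) \<le> 2"
proof -
  have "(\<Sum>j\<le>K. 1 / (1 + real j)\<^sup>2) \<le> 2 - 1 / (1 + real K)"
  proof (induction K)
    case (Suc K)
    have "1 / (2 + real K)\<^sup>2 \<le> 1 / ((1 + real K) * (2 + real K))"
      unfolding power2_eq_square by (intro frac_le mult_right_mono) auto
    also have "\<dots> = 1 / (1 + real K) - 1 / (2 + real K)" by (simp add: field_simps)
    finally have "1 / (2 + real K)\<^sup>2 \<le> 1 / (1 + real K) - 1 / (2 + real K)" .
    then show ?case using Suc by (simp add: add.commute add.left_commute)
  qed simp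
  also have "\<dots> \<le> 2" by simp
  finally show ?thesis .
qed

text \<open>A finite Euler product argument: an integer with all prime factors in \<open>S\<close>
  is determined by its exponents there, so the sum is dominated by a product over \<open>S\<close>
  of sums over single exponents, each at most 2.\<close>

lemma sum_smooth_le:
  assumes S: "finite S" "\<forall>r\<in>S. prime (r :: nat)" and F: "finite F"
    and smooth: "\<And>n. n \<in> F \<Longrightarrow> n > 0 \<and> prime_factors n \<subseteq> S"
  shows "(\<Sum>n\<in>F. 1 / (\<Prod>r\<in>S. (1 + real (multiplicity r n))\<^sup>2)) \<le> 2 ^ card S"
proof -
  define \<phi> where "\<phi> = (\<lambda>n. restrict (\<lambda>r. multiplicity r n) S)"
  \<comment> \<open>\<open>K\<close> bounds all exponents that occur; the inserted 0 keeps the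
    maximum meaningful when there are none.\<close>
  define K where "K = Max (insert 0 ((\<lambda>(n, r). multiplicity r n) ` (F \<times> S)))"
  define g where "g = (\<lambda>f. \<Prod>r\<in>S. 1 / (1 + real (f r))\<^sup>2)"
  have inj: "inj_on \<phi> F"
  proof (rule inj_onI)
    fix m n assume mn: "m \<in> F" "n \<in> F" "\<phi> m = \<phi> n"
    have "multiplicity r m = multiplicity r n" if "prime r" for r
    proof (cases "r \<in> S")
      case True
      then show ?thesis using mn(3) by (metis \<phi>_def restrict_apply')
    next
      case False
      have "multiplicity r x = 0" if "x \<in> F" for x
      proof -
        have "r \<notin> prime_factors x" "x > 0" using smooth[OF that] False by auto
        then show ?thesis
          using \<open>prime r\<close> by (simp add: prime_factors_dvd not_dvd_imp_multiplicity_0)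
      qed
      then show ?thesis using mn(1,2) by simp
    qed
    then show "m = n" 
      using smooth[OF mn(1)] smooth[OF mn(2)] by (metis multiplicity_eq_nat)
  qed
  have "(\<Sum>n\<in>F. 1 / (\<Prod>r\<in>S. (1 + real (multiplicity r n))\<^sup>2)) = (\<Sum>n\<in>F. g (\<phi> n))"
    unfolding g_def \<phi>_def by (intro sum.cong refl) (simp add: prod_dividef)
  also have "\<dots> = sum g (\<phi> ` F)" by (simp add: sum.reindex[OF inj])
  also have "\<dots> \<le> sum g (PiE S (\<lambda>_. {..K}))"
  proof (rule sum_mono2)
    show "finite (PiE S (\<lambda>_. {..K}))" using S by (intro finite_PiE) auto
    have "multiplicity r n \<le> K" if "n \<in> F" "r \<in> S" for n r
      unfolding K_def
    proof (rule Max_ge)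
      show "multiplicity r n \<in> insert 0 ((\<lambda>(n, r). multiplicity r n) ` (F \<times> S))"
        by (rule insertI2, rule image_eqI[of _ _ "(n, r)"]) (simp_all add: that)
    qed (use F S in simp)
    then show "\<phi> ` F \<subseteq> PiE S (\<lambda>_. {..K})" by (auto simp: \<phi>_def)
  qed (auto simp: g_def intro!: prod_nonneg)
  also have "\<dots> = (\<Prod>r\<in>S. \<Sum>j\<le>K. 1 / (1 + real j)\<^sup>2)"
    unfolding g_def using S by (subst prod_sum_PiE) auto
  also have "\<dots> \<le> (\<Prod>r\<in>S. 2)"
    by (intro prod_mono conjI sum_nonneg sum_inverse_squares_le) auto
  finally show ?thesis by simp
qed

text \<open>The coefficients of \<open>q ^ k\<close> decay like \<open>1 / w n\<close> and are
  supported on integers composed of the primes in \<open>S\<close>, over which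
  \<open>1 / w n\<close> has a bounded sum. Summation therefore costs only a factor
  \<open>2 ^ card S\<close>.\<close>

lemma norm_inverse_power_le:
  fixes p :: "'a::comm_complex_banach_algebra_1 ell"
  assumes b: "bounded_inverse p M" and p: "finsupp p" and M: "M \<ge> 0"
  obtains C J where "\<And>\<sigma> q k. \<sigma> \<ge> 0 \<Longrightarrow> twist \<sigma> p * q = 1 \<Longrightarrow> norm (q ^ k) \<le> C * real (k + 1) ^ J * M ^ k"
proof -
  define S where "S = (\<Union>n\<in>{n. coeff p n \<noteq> 0}. prime_factors n)"
  have S: "finite S" "\<forall>r\<in>S. prime r"
    using p unfolding S_def finsupp_def by auto
  define w where "w = (\<lambda>n. \<Prod>r\<in>S. (1 + real (multiplicity r n))\<^sup>2)"
  have w: "w n > 0" for n unfolding w_def by (intro prod_pos) (auto intro: add_pos_nonneg)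
  have one: "finsupp (1 :: 'a ell)"
    unfolding finsupp_def by (rule finite_subset[of _ "{1}"]) (auto simp: one_ell.rep_eq dunit_def)
  have twist1: "twist \<sigma> (1 :: 'a ell) = 1" if "\<sigma> \<ge> 0" for \<sigma>
    by (rule ell_eqI) (simp add: coeff_twist that one_ell.rep_eq dunit_def)
  have pe: "power_estimate p M w"
    unfolding w_def by (rule power_estimate_prod[OF b p M S])
  obtain C J where C: "C \<ge> 0" and est0: "\<forall>\<sigma>\<ge>0. \<forall>q. twist \<sigma> p * q = 1 \<longrightarrow>
     (\<forall>k n. w n * norm (coeff (of_nat k ^ 0 * q ^ (k + 0) * twist \<sigma> 1) n) \<le> C * real (k + 1) ^ J * M ^ k)"
    using pe[unfolded power_estimate_def, rule_format, OF one, of 0 0] by (elim exE conjE)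
  have est: "w n * norm (coeff (q ^ k) n) \<le> C * real (k + 1) ^ J * M ^ k"
    if "\<sigma> \<ge> 0" "twist \<sigma> p * q = 1" for \<sigma> q k n
    using est0[rule_format, OF that, of n k] by (simp add: twist1[OF that(1)])
  have "norm (q ^ k) \<le> C * 2 ^ card S * real (k + 1) ^ J * M ^ k" if \<sigma>: "\<sigma> \<ge> 0" and q: "twist \<sigma> p * q = 1" for \<sigma> q k
  proof (rule norm_ell_leI)
    fix N
    define F where "F = {n. n < N \<and> coeff (q ^ k) n \<noteq> 0}"
    have smooth: "prime_factors n \<subseteq> S" if "n \<in> F" for n
    proof
      fix r assume r: "r \<in> prime_factors n"
      show "r \<in> S"
      proof (rule ccontr)
        assume "r \<notin> S"
        have "prime r" using r by auto
        have z: "real (multiplicity r m) *\<^sub>R coeff p m = 0" for m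
        proof (cases "coeff p m = 0")
          case False
          then have "r \<notin> prime_factors m" using \<open>r \<notin> S\<close> by (auto simp: S_def)
          moreover have "m \<noteq> 0" using False by (metis coeff_0)
          ultimately have "multiplicity r m = 0"
            using \<open>prime r\<close> by (auto simp: prime_factors_dvd not_dvd_imp_multiplicity_0)
          then show ?thesis by simp
        qed simp
        \<comment> \<open>A prime outside \<open>S\<close> divides no index in the support of
          \<open>p\<close>. Its derivation kills the twist and, by the formula for inverse powers,
          also \<open>q ^ k\<close>, so \<open>r\<close> divides no index in the support of
          \<open>q ^ k\<close>.\<close>
        have "derives (\<lambda>n. real (multiplicity r n)) (twist \<sigma> p) 0"
          unfolding derives_def
        proof
          fix n show "coeff 0 n = real (multiplicity r n) *\<^sub>R coeff (twist \<sigma> p) n"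
            using z[of n] by (auto simp: coeff_twist[OF \<sigma>])
        qed
        from derives_inverse_power[OF additive_weight_multiplicity[OF \<open>prime r\<close>] this q, of k]
        have "real (multiplicity r n) *\<^sub>R coeff (q ^ k) n = 0" by (simp add: derives_def)
        then have "multiplicity r n = 0" using that by (simp add: F_def)
        moreover have "n > 0" using that by (cases "n = 0") (simp_all add: F_def)
        ultimately show False using r by (simp add: prime_factors_multiplicity)
      qed
    qed
    have pos: "n > 0" if "n \<in> F" for n using that by (cases "n = 0") (simp_all add: F_def)
    have "finite F" by (simp add: F_def)
    have "(\<Sum>n\<in>F. 1 / w n) \<le> 2 ^ card S"
      unfolding w_def by (rule sum_smooth_le[OF S \<open>finite F\<close>]) (simp add: smooth pos)
    then have "(\<Sum>n\<in>F. 1 / w n) * (C * real (k + 1) ^ J * M ^ k) \<le> 2 ^ card S * (C * real (k + 1) ^ J * M ^ k)"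
      using C M by (intro mult_right_mono) auto
    moreover have "(\<Sum>n<N. norm (coeff (q ^ k) n)) = (\<Sum>n\<in>F. norm (coeff (q ^ k) n))"
      by (rule sum.mono_neutral_right) (auto simp: F_def)
    moreover have "\<dots> \<le> (\<Sum>n\<in>F. 1 / w n) * (C * real (k + 1) ^ J * M ^ k)"
      unfolding sum_distrib_right
    proof (rule sum_mono)
      fix n show "norm (coeff (q ^ k) n) \<le> (1 / w n) * (C * real (k + 1) ^ J * M ^ k)"
        using est[OF \<sigma> q, of n k] w[of n] by (simp add: pos_le_divide_eq mult.commute)
    qed
    ultimately show "(\<Sum>n<N. norm (coeff (q ^ k) n)) \<le> C * 2 ^ card S * real (k + 1) ^ J * M ^ k"
      by (simp add: mult_ac)
  qed
  then show thesis by (rule that)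
qed

section \<open>Invertibility\<close>

text \<open>The Neumann series, under summability of the norms of the powers: in
  \<open>ell_invertible\<close> the norm of \<open>x\<close> itself may exceed 1.\<close>

lemma one_minus_invertible:
  fixes x :: "'b::{real_normed_algebra_1, banach}"
  assumes "summable (\<lambda>n. norm (x ^ n))"
  shows "\<exists>y. (1 - x) * y = 1"
proof -
  have s: "summable (\<lambda>n. x ^ n)" by (rule summable_norm_cancel[OF assms])
  have "(1 - x) * (\<Sum>n. x ^ n) = (\<Sum>n. x ^ n) - (\<Sum>n. x ^ Suc n)"
    using suminf_mult[OF s, of x] by (simp add: algebra_simps)
  also have "\<dots> = 1" using suminf_split_head[OF s] by simp
  finally show ?thesis by blast
qed

lemma invertible_perturbation:
  fixes a b q :: "'b::{comm_ring_1, real_normed_algebra_1, banach}"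
  assumes "a * q = 1" "norm (b - a) * norm q < 1"
  shows "\<exists>r. b * r = 1"
proof -
  define x where "x = (a - b) * q"
  have "norm x < 1"
    using norm_mult_ineq[of "a - b" q] assms(2) by (simp add: x_def norm_minus_commute)
  then have "summable (\<lambda>n. norm (x ^ n))"
    by (intro summable_comparison_test'[OF summable_geometric[of "norm x"]]) (auto simp: norm_power_ineq)
  then obtain y where "(1 - x) * y = 1" using one_minus_invertible by blast
  moreover have "1 - x = b * q" using assms(1) by (simp add: x_def algebra_simps)
  ultimately have "b * (q * y) = 1" by (simp add: mult.assoc)
  then show ?thesis by blast
qed

text \<open>The resolvent identity \<open>r = q + (a - b) * (q * r)\<close> gives
  \<open>norm r \<le> norm q + norm r / 2\<close>.\<close>

lemma norm_perturbed_inverse_le: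
  fixes a b q r :: "'b::{comm_ring_1, real_normed_algebra_1}"
  assumes "a * q = 1" "b * r = 1" "norm (b - a) * norm q \<le> 1 / 2"
  shows "norm r \<le> 2 * norm q"
proof -
  have "(a - b) * (q * r) = (a * q) * r - q * (b * r)" by (simp add: algebra_simps)
  then have "r = q + (a - b) * (q * r)" using assms(1,2) by simp
  then have "norm r \<le> norm q + norm ((a - b) * (q * r))" by (metis norm_triangle_ineq)
  also have "norm ((a - b) * (q * r)) \<le> norm (b - a) * norm q * norm r"
    using mult_left_mono[OF norm_mult_ineq[of q r], of "norm (b - a)"] norm_mult_ineq[of "a - b" "q * r"]
    by (simp add: norm_minus_commute mult.assoc)
  also have "\<dots> \<le> 1 / 2 * norm r" using assms(3) by (intro mult_right_mono) auto
  finally show ?thesis by simp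
qed

section \<open>Invertibility of the twists for large \<open>\<sigma>\<close>\<close>

definition const_ell :: "'a::{comm_ring_1, real_normed_algebra_1} \<Rightarrow> 'a ell" where
  "const_ell x = Ell (\<lambda>n. x * dunit n)"

lemma coeff_const_ell: "coeff (const_ell x) n = x * dunit n"
proof -
  have "summable (\<lambda>n. norm (x * dunit n))"
    by (rule summable_finite[of "{1}"]) (auto simp: dunit_def)
  then show ?thesis by (simp add: const_ell_def Ell_inverse ell1_def dunit_def)
qed

lemma const_ell_inverse:
  assumes "x * y = 1" shows "const_ell x * const_ell y = 1"
proof (rule ell_eqI)
  fix n
  have "coeff (const_ell x * const_ell y) n = dconv (\<lambda>n. x * dunit n) (\<lambda>n. y * dunit n) n"
    by (simp add: coeff_times coeff_const_ell[abs_def])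
  also have "\<dots> = x * dconv dunit (\<lambda>n. y * dunit n) n"
    by (simp add: dconv_def sum_distrib_left case_prod_unfold mult.assoc)
  also have "\<dots> = (x * y) * dunit n"
    by (subst dconv_unit_left) (simp_all add: dunit_def)
  finally show "coeff (const_ell x * const_ell y) n = coeff 1 n"
    by (simp add: assms one_ell.rep_eq)
qed

lemma dser_const_ell: "dser (coeff (const_ell x)) s = (x :: 'a::comm_complex_banach_algebra_1)"
  by (subst dser_eq_sum[of 2])
     (auto simp: coeff_const_ell dunit_def numeral_2_eq_2 scaleC_one scaleC_zero_left scaleC_zero_right)

text \<open>A twist leaves the coefficient at 1 unchanged and damps every index from 2 on by at
  least the factor \<open>2 powr (- \<sigma>)\<close>.\<close>

lemma norm_twist_minus_const_le:
  assumes "\<sigma> \<ge> 0"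
  shows "norm (twist \<sigma> p - const_ell (coeff p 1)) \<le> 2 powr (- \<sigma>) * norm p"
proof (rule norm_ell_leI)
  fix N
  have "norm (coeff (twist \<sigma> p - const_ell (coeff p 1)) n) \<le> 2 powr (- \<sigma>) * norm (coeff p n)" for n
  proof -
    consider "n = 0" | "n = 1" | "n \<ge> 2" by linarith
    then show ?thesis
    proof cases
      case 3
      then have "real n powr (- \<sigma>) \<le> 2 powr (- \<sigma>)"
        using assms by (intro powr_mono2') auto
      then show ?thesis
        using 3 by (simp add: coeff_twist assms coeff_const_ell dunit_def mult_right_mono)
    qed (simp_all add: coeff_twist assms coeff_const_ell dunit_def)
  qed
  then have "(\<Sum>n<N. norm (coeff (twist \<sigma> p - const_ell (coeff p 1)) n)) \<le> (\<Sum>n<N. 2 powr (- \<sigma>) * norm (coeff p n))"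
    by (intro sum_mono)
  also have "\<dots> \<le> 2 powr (- \<sigma>) * norm p"
    by (simp add: sum_distrib_left[symmetric] sum_norm_coeff_le)
  finally show "(\<Sum>n<N. norm (coeff (twist \<sigma> p - const_ell (coeff p 1)) n)) \<le> 2 powr (- \<sigma>) * norm p" .
qed

lemma ex_two_powr_minus_mult_less_1:
  obtains \<sigma> :: real where "\<sigma> \<ge> 0" "2 powr (- \<sigma>) * K < 1"
proof -
  obtain n where "(1 / 2) ^ n < 1 / (\<bar>K\<bar> + 1)"
    using real_arch_pow_inv[of "1 / (\<bar>K\<bar> + 1)" "1 / 2"]
    by (force simp: add_nonneg_pos)
  then have "(1 / 2) ^ n * (\<bar>K\<bar> + 1) < 1" by (simp add: pos_less_divide_eq)
  moreover have "(1 / 2) ^ n * K \<le> (1 / 2) ^ n * (\<bar>K\<bar> + 1)" by (rule mult_left_mono) auto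
  ultimately have "(1 / 2) ^ n * K < 1" by (rule le_less_trans[rotated])
  moreover have "2 powr (- real n) = (1 / 2) ^ n"
    by (simp add: powr_minus powr_realpow power_one_over inverse_eq_divide)
  ultimately show thesis by (intro that[of "real n"]) simp_all
qed

text \<open>For large real \<open>\<sigma>\<close> the value of the series is close to
  \<open>coeff p 1\<close> and has an inverse bounded by \<open>M\<close>, so
  \<open>coeff p 1\<close> is a unit. A possibly larger \<open>\<sigma>\<close> then brings the
  twist close enough to the invertible constant \<open>const_ell (coeff p 1)\<close>.\<close>

lemma twist_invertible_at_infinity:
  fixes p :: "'a::comm_complex_banach_algebra_1 ell"
  assumes b: "bounded_inverse p M" and M: "M \<ge> 0"
  obtains \<sigma> q where "\<sigma> \<ge> 0" "twist \<sigma> p * q = 1"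
proof -
  obtain u where u: "coeff p 1 * u = 1"
  proof -
    obtain \<sigma> :: real where \<sigma>: "\<sigma> \<ge> 0" "2 powr (- \<sigma>) * (norm p * M) < 1"
      by (rule ex_two_powr_minus_mult_less_1)
    have 0: "0 \<in> halfplane" by (simp add: halfplane_def)
    have "of_real \<sigma> \<in> halfplane" using \<sigma> by (simp add: halfplane_def)
    then obtain y where y: "dser (coeff p) (of_real \<sigma>) * y = 1" "norm y \<le> M"
      using b unfolding bounded_inverse_def by blast
    have eq: "dser (coeff (twist \<sigma> p - const_ell (coeff p 1))) 0 = dser (coeff p) (of_real \<sigma>) - coeff p 1"
      using linear_diff[OF bounded_linear.linear[OF bounded_linear_dser[OF 0]], of "twist \<sigma> p" "const_ell (coeff p 1)"]
      by (simp only: dser_twist[OF \<sigma>(1)] dser_const_ell) simp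
    have "norm (dser (coeff p) (of_real \<sigma>) - coeff p 1) \<le> 2 powr (- \<sigma>) * norm p"
      unfolding eq[symmetric] by (rule order_trans[OF norm_dser_le[OF 0] norm_twist_minus_const_le[OF \<sigma>(1)]])
    then have "norm (coeff p 1 - dser (coeff p) (of_real \<sigma>)) * norm y \<le> 2 powr (- \<sigma>) * norm p * M"
      using y(2) M by (intro mult_mono) (auto simp: norm_minus_commute)
    then have "norm (coeff p 1 - dser (coeff p) (of_real \<sigma>)) * norm y < 1"
      using \<sigma>(2) by (simp add: mult.assoc)
    from invertible_perturbation[OF y(1) this] show thesis using that by blast
  qed
  obtain \<sigma> :: real where \<sigma>: "\<sigma> \<ge> 0" "2 powr (- \<sigma>) * (norm p * norm (const_ell u)) < 1"
    by (rule ex_two_powr_minus_mult_less_1)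
  have "norm (twist \<sigma> p - const_ell (coeff p 1)) * norm (const_ell u) \<le> 2 powr (- \<sigma>) * norm p * norm (const_ell u)"
    by (intro mult_right_mono norm_twist_minus_const_le \<sigma>) auto
  then have "norm (twist \<sigma> p - const_ell (coeff p 1)) * norm (const_ell u) < 1"
    using \<sigma>(2) by (simp add: mult.assoc)
  from invertible_perturbation[OF const_ell_inverse[OF u] this] show thesis using that \<sigma>(1) by blast
qed

section \<open>Continuity of the twists in \<open>\<sigma>\<close> and descent to 0\<close>

lemma abs_exp_minus_diff_le:
  fixes x y :: real
  assumes "x \<ge> 0" "y \<ge> 0" shows "\<bar>exp (- x) - exp (- y)\<bar> \<le> \<bar>x - y\<bar>"
  using assms
proof (induction x y rule: linorder_wlog)
  case (le x y)
  have "exp (- x) - exp (- y) = exp (- x) * (1 - exp (- (y - x)))"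
    by (simp add: algebra_simps flip: exp_add)
  also have "1 - exp (- (y - x)) \<le> y - x" using exp_ge_add_one_self[of "- (y - x)"] by linarith
  then have "exp (- x) * (1 - exp (- (y - x))) \<le> 1 * (y - x)"
    using le by (intro mult_mono) auto
  finally show ?case using le by simp
qed (simp add: abs_minus_commute)

text \<open>Each factor \<open>n powr (- \<sigma>)\<close> is Lipschitz in \<open>\<sigma>\<close>
  with constant \<open>ln n\<close>, and finite support makes the sequence weighted by
  \<open>ln n\<close> summable.\<close>

lemma norm_twist_diff_le:
  assumes p: "finsupp p" and "\<sigma> \<ge> 0" "\<tau> \<ge> 0"
  shows "norm (twist \<sigma> p - twist \<tau> p) \<le> norm (wmul (\<lambda>n. ln (real n)) p) * \<bar>\<sigma> - \<tau>\<bar>"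
proof (rule norm_ell_leI)
  fix N
  have "norm (coeff (twist \<sigma> p - twist \<tau> p) n) \<le> norm (coeff (wmul (\<lambda>n. ln (real n)) p) n) * \<bar>\<sigma> - \<tau>\<bar>" for n
  proof (cases "n = 0")
    case False
    have "\<bar>real n powr (- \<sigma>) - real n powr (- \<tau>)\<bar> = \<bar>exp (- (\<sigma> * ln (real n))) - exp (- (\<tau> * ln (real n)))\<bar>"
      using False by (simp add: powr_def)
    also have "\<dots> \<le> \<bar>\<sigma> * ln (real n) - \<tau> * ln (real n)\<bar>"
      using False assms by (intro abs_exp_minus_diff_le) auto
    also have "\<dots> = \<bar>ln (real n)\<bar> * \<bar>\<sigma> - \<tau>\<bar>"
      by (simp add: abs_mult flip: left_diff_distrib)
    finally have "\<bar>real n powr (- \<sigma>) - real n powr (- \<tau>)\<bar> * norm (coeff p n) \<le> (\<bar>ln (real n)\<bar> * \<bar>\<sigma> - \<tau>\<bar>) * norm (coeff p n)"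
      by (intro mult_right_mono) auto
    then show ?thesis
      using assms by (simp add: coeff_twist coeff_wmul_finsupp mult_ac flip: scaleR_left_diff_distrib)
  qed simp
  then have "(\<Sum>n<N. norm (coeff (twist \<sigma> p - twist \<tau> p) n))
      \<le> (\<Sum>n<N. norm (coeff (wmul (\<lambda>n. ln (real n)) p) n) * \<bar>\<sigma> - \<tau>\<bar>)"
    by (intro sum_mono)
  also have "\<dots> \<le> norm (wmul (\<lambda>n. ln (real n)) p) * \<bar>\<sigma> - \<tau>\<bar>"
    by (simp add: sum_distrib_right[symmetric] sum_norm_coeff_le mult_right_mono)
  finally show "(\<Sum>n<N. norm (coeff (twist \<sigma> p - twist \<tau> p) n)) \<le> norm (wmul (\<lambda>n. ln (real n)) p) * \<bar>\<sigma> - \<tau>\<bar>" .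
qed

text \<open>Invertibility of the twists is propagated from large \<open>\<sigma>\<close> down to \<open>0\<close> in steps whose
  length depends only on the uniform bound for the inverses.\<close>

lemma finsupp_invertible:
  fixes p :: "'a::comm_complex_banach_algebra_1 ell"
  assumes b: "bounded_inverse p M" and p: "finsupp p" and M: "M \<ge> 0"
  shows "\<exists>q. p * q = 1"
proof -
  obtain \<sigma>0 q0 where \<sigma>0: "\<sigma>0 \<ge> 0" "twist \<sigma>0 p * q0 = 1"
    by (rule twist_invertible_at_infinity[OF b M])
  obtain C J where CJ: "\<And>\<sigma> q k. \<sigma> \<ge> 0 \<Longrightarrow> twist \<sigma> p * q = 1 \<Longrightarrow> norm (q ^ k) \<le> C * real (k + 1) ^ J * M ^ k"
    using norm_inverse_power_le[OF b p M] by blast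
  \<comment> \<open>The power bound at \<open>k = 1\<close>, enlarged to be positive.\<close>
  define B where "B = \<bar>C * 2 ^ J * M\<bar> + 1"
  have B: "norm q \<le> B" if "\<sigma> \<ge> 0" "twist \<sigma> p * q = 1" for \<sigma> q
    using CJ[OF that, of 1] by (simp add: B_def)
  have "B > 0" by (simp add: B_def add_nonneg_pos)
  define L where "L = norm (wmul (\<lambda>n. ln (real n)) p) + 1"
  have "L > 0" by (simp add: L_def add_nonneg_pos)
  \<comment> \<open>With this step length \<open>L * d * B = 1 / 2\<close>, which suffices for the
    perturbation argument.\<close>
  define d where "d = 1 / (2 * L * B)"
  have "d > 0" using \<open>B > 0\<close> \<open>L > 0\<close> by (simp add: d_def)
  have step: "\<exists>r. twist \<tau> p * r = 1"
    if "\<sigma> \<ge> 0" "\<tau> \<ge> 0" "\<bar>\<tau> - \<sigma>\<bar> \<le> d" "twist \<sigma> p * q = 1" for \<sigma> \<tau> q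
  proof (rule invertible_perturbation[OF that(4)])
    have "norm (twist \<tau> p - twist \<sigma> p) \<le> (L - 1) * \<bar>\<tau> - \<sigma>\<bar>"
      using norm_twist_diff_le[OF p that(2,1)] by (simp add: L_def)
    also have "\<dots> \<le> L * d" using that(3) \<open>L > 0\<close> by (intro mult_mono) auto
    finally have "norm (twist \<tau> p - twist \<sigma> p) * norm q \<le> L * d * B"
      using B[OF that(1,4)] \<open>L > 0\<close> \<open>d > 0\<close> by (intro mult_mono) auto
    also have "\<dots> < 1" using \<open>L > 0\<close> \<open>B > 0\<close> by (simp add: d_def)
    finally show "norm (twist \<tau> p - twist \<sigma> p) * norm q < 1" .
  qed
  \<comment> \<open>The maximum stops the descent at 0, where the estimates cease to apply.\<close>
  have "\<exists>r. twist (max 0 (\<sigma>0 - real m * d)) p * r = 1" for m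
  proof (induction m)
    case 0
    then show ?case using \<sigma>0 by auto
  next
    case (Suc m)
    then obtain r where "twist (max 0 (\<sigma>0 - real m * d)) p * r = 1" by blast
    then show ?case
      by (rule step[rotated 3]) (use \<open>d > 0\<close> in \<open>auto simp: algebra_simps max_def\<close>)
  qed
  moreover obtain m where "\<sigma>0 < real m * d" using ex_less_of_nat_mult[OF \<open>d > 0\<close>] by blast
  ultimately have "\<exists>r. twist 0 p * r = 1" by (metis diff_gt_0_iff_gt max.absorb1 less_imp_le diff_le_0_iff_le)
  then show ?thesis by (simp add: twist_0)
qed

text \<open>The powers of \<open>q\<close> grow no faster than \<open>(2 * M) ^ k\<close> up to a
  polynomial, whereas those of \<open>p - a\<close> are at most \<open>(1 / (4 * M)) ^ k\<close>.
  Hence the Neumann series for \<open>a * q\<close> converges, however large \<open>norm q\<close>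
  is.\<close>

lemma ell_invertible:
  fixes a :: "'a::comm_complex_banach_algebra_1 ell"
  assumes "bounded_inverse a M0"
  shows "\<exists>q. a * q = 1"
proof -
  define M where "M = max M0 1"
  have M: "M > 0" and b: "bounded_inverse a M"
    using assms unfolding M_def bounded_inverse_def by (auto simp: le_max_iff_disj)
  \<comment> \<open>The constant 4 serves twice: the pointwise perturbation is at most 1/4, so
    inverse bounds at most double, and the ratio \<open>1 / (4 * M) * (2 * M)\<close> in the Neumann
    series is 1/2.\<close>
  obtain N where N: "norm (trunc N a - a) < 1 / (4 * M)"
    using metric_LIMSEQ_D[OF tendsto_trunc[of a], of "1 / (4 * M)"] M by (auto simp: dist_norm)
  define p where "p = trunc N a"
  have b': "bounded_inverse p (2 * M)"
    unfolding bounded_inverse_def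
  proof
    fix s assume s: "s \<in> halfplane"
    then obtain y where y: "dser (coeff a) s * y = 1" "norm y \<le> M"
      using b unfolding bounded_inverse_def by blast
    have eq: "dser (coeff (p - a)) s = dser (coeff p) s - dser (coeff a) s"
      by (rule linear_diff[OF bounded_linear.linear[OF bounded_linear_dser[OF s]]])
    have "norm (dser (coeff p) s - dser (coeff a) s) \<le> 1 / (4 * M)"
      unfolding eq[symmetric] using N by (intro order_trans[OF norm_dser_le[OF s]]) (simp add: p_def)
    then have "norm (dser (coeff p) s - dser (coeff a) s) * norm y \<le> 1 / (4 * M) * M"
      using y(2) M by (intro mult_mono) auto
    then have le: "norm (dser (coeff p) s - dser (coeff a) s) * norm y \<le> 1 / 4" using M by simp
    then obtain r where r: "dser (coeff p) s * r = 1"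
      using invertible_perturbation[OF y(1), of "dser (coeff p) s"] by auto
    moreover have "norm r \<le> 2 * norm y"
      using le by (intro norm_perturbed_inverse_le[OF y(1) r]) auto
    ultimately show "\<exists>y. dser (coeff p) s * y = 1 \<and> norm y \<le> 2 * M" using y(2) by force
  qed
  have p: "finsupp p" by (simp add: p_def finsupp_trunc)
  obtain q where q: "p * q = 1" using finsupp_invertible[OF b' p] M by auto
  obtain C J where CJ: "\<And>\<sigma> q k. \<sigma> \<ge> 0 \<Longrightarrow> twist \<sigma> p * q = 1 \<Longrightarrow> norm (q ^ k) \<le> C * real (k + 1) ^ J * (2 * M) ^ k"
    using norm_inverse_power_le[OF b' p] M by (auto intro: less_imp_le)
  define x where "x = (p - a) * q"
  have x: "norm (x ^ k) \<le> C * (real (k + 1) ^ J * (1 / 2) ^ k)" for k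
  proof -
    have "norm (x ^ k) \<le> norm ((p - a) ^ k) * norm (q ^ k)"
      unfolding x_def power_mult_distrib by (rule norm_mult_ineq)
    also have "\<dots> \<le> (1 / (4 * M)) ^ k * (C * real (k + 1) ^ J * (2 * M) ^ k)"
    proof (intro mult_mono CJ[of 0])
      show "norm ((p - a) ^ k) \<le> (1 / (4 * M)) ^ k"
        using N unfolding p_def
        by (intro order_trans[OF norm_power_ineq] power_mono) auto
    qed (use q M in \<open>auto simp: twist_0\<close>)
    also have "\<dots> = C * real (k + 1) ^ J * (1 / (4 * M) * (2 * M)) ^ k"
      by (simp only: power_mult_distrib mult_ac)
    also have "1 / (4 * M) * (2 * M) = 1 / 2" using M by simp
    finally show ?thesis by (simp add: mult.assoc)
  qed
  have "summable (\<lambda>k. real (k + 1) ^ J * (1 / 2) ^ k)"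
  proof (rule summable_comparison_test_bigo)
    \<comment> \<open>Any ratio strictly between 1/2 and 1 absorbs the polynomial factor.\<close>
    show "summable (\<lambda>k. norm ((3 / 4 :: real) ^ k))" by simp
    show "(\<lambda>k. real (k + 1) ^ J * (1 / 2) ^ k) \<in> O(\<lambda>k. (3 / 4) ^ k)" by real_asymp
  qed
  then have "summable (\<lambda>k. C * (real (k + 1) ^ J * (1 / 2) ^ k))" by (rule summable_mult)
  then have "summable (\<lambda>k. norm (x ^ k))"
    by (rule summable_comparison_test'[where N = 0]) (unfold real_norm_def abs_norm_cancel, rule x)
  then obtain y where "(1 - x) * y = 1" using one_minus_invertible by blast
  moreover have "1 - x = a * q" using q by (simp add: x_def algebra_simps)
  ultimately have "a * (q * y) = 1" by (simp add: mult.assoc)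
  then show ?thesis by blast
qed

section \<open>Compactness of the closed range and bounds for inverses\<close>

lemma compact_closure_dser_range:
  fixes a :: "'a::comm_complex_banach_algebra_1 ell"
  shows "compact (closure (dser (coeff a) ` halfplane))"
  unfolding compact_eq_totally_bounded
proof (intro conjI allI impI)
  show "complete (closure (dser (coeff a) ` halfplane))" by (simp add: complete_eq_closed)
  fix e :: real assume "e > 0"
  \<comment> \<open>Total boundedness with \<open>e\<close> split in three: truncating the series,
    covering the values of the truncation, and passing to the closure.\<close>
  then obtain N where N: "norm (trunc N a - a) < e / 3"
    using metric_LIMSEQ_D[OF tendsto_trunc[of a], of "e / 3"] by (auto simp: dist_norm)
  \<comment> \<open>\<open>Z\<close> is built up as a finite sum of compact images of the closed
    unit disc. It contains all values of the truncation, because \<open>n powr (- s)\<close> has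
    modulus at most 1 on \<open>halfplane\<close>.\<close>
  have "\<exists>Z. compact Z \<and> (\<forall>z. (\<forall>n. cmod (z n) \<le> 1) \<longrightarrow> (\<Sum>n<N. scaleC (z n) (c n)) \<in> Z)" for c :: "nat \<Rightarrow> 'a" and N
  proof (induction N)
    case 0
    show ?case by (rule exI[of _ "{0}"]) simp
  next
    case (Suc N)
    then obtain Z where Z: "compact Z" "\<And>z. (\<forall>n. cmod (z n) \<le> 1) \<Longrightarrow> (\<Sum>n<N. scaleC (z n) (c n)) \<in> Z"
      by blast
    have "compact ((\<lambda>w. scaleC w (c N)) ` cball 0 1)"
      by (intro compact_continuous_image bounded_linear.continuous_on[OF
            bounded_bilinear.bounded_linear_left[OF bounded_bilinear_scaleC]] continuous_on_id) simp
    then have "compact {x + y |x y. x \<in> Z \<and> y \<in> (\<lambda>w. scaleC w (c N)) ` cball 0 1}"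
      by (rule compact_sums[OF Z(1)])
    then show ?case
      by (intro exI[of _ "{x + y |x y. x \<in> Z \<and> y \<in> (\<lambda>w. scaleC w (c N)) ` cball 0 1}"]) (use Z(2) in force)
  qed
  then obtain Z where Z: "compact Z" "\<And>z. (\<forall>n. cmod (z n) \<le> 1) \<Longrightarrow> (\<Sum>n<N. scaleC (z n) (coeff (trunc N a) n)) \<in> Z"
    by metis
  obtain F where F: "finite F" "Z \<subseteq> (\<Union>x\<in>F. ball x (e / 3))"
    using Z(1) \<open>e > 0\<close> unfolding compact_eq_totally_bounded by (metis zero_less_divide_iff zero_less_numeral)
  have "closure (dser (coeff a) ` halfplane) \<subseteq> (\<Union>x\<in>F. ball x e)"
  proof
    fix x assume "x \<in> closure (dser (coeff a) ` halfplane)"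
    then obtain s where s: "s \<in> halfplane" "dist (dser (coeff a) s) x < e / 3"
      using \<open>e > 0\<close> by (force simp: closure_approachable dest: spec[of _ "e / 3"])
    have "dser (coeff (trunc N a)) s = (\<Sum>n<N. scaleC (of_nat n powr (- s)) (coeff (trunc N a) n))"
      by (rule dser_eq_sum) (simp add: coeff_trunc)
    then have "dser (coeff (trunc N a)) s \<in> Z"
      using Z(2)[of "\<lambda>n. of_nat n powr (- s)"] norm_powr_halfplane_le[OF s(1)] by simp
    then obtain y where y: "y \<in> F" "dist y (dser (coeff (trunc N a)) s) < e / 3" using F by auto
    have eq: "dser (coeff (trunc N a - a)) s = dser (coeff (trunc N a)) s - dser (coeff a) s"
      by (rule linear_diff[OF bounded_linear.linear[OF bounded_linear_dser[OF s(1)]]])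
    have "dist (dser (coeff (trunc N a)) s) (dser (coeff a) s) < e / 3"
      unfolding dist_norm eq[symmetric] by (rule le_less_trans[OF norm_dser_le[OF s(1)] N])
    then have "dist y x < e"
      using y(2) s(2) dist_triangle[of y x "dser (coeff (trunc N a)) s"]
        dist_triangle[of "dser (coeff (trunc N a)) s" x "dser (coeff a) s"] by linarith
    then show "x \<in> (\<Union>x\<in>F. ball x e)" using y(1) by auto
  qed
  then show "\<exists>k. finite k \<and> closure (dser (coeff a) ` halfplane) \<subseteq> (\<Union>x\<in>k. ball x e)"
    using F(1) by blast
qed

text \<open>If the inverses were unbounded along a sequence, a subsequence would converge to a unit
  \<open>l\<close> with inverse \<open>q\<close>. Near \<open>l\<close> all inverses have norm at
  most \<open>2 * norm q\<close>, a contradiction.\<close>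

lemma compact_units_bounded_inverse:
  fixes K :: "'a::{comm_ring_1, real_normed_algebra_1, banach} set"
  assumes "compact K" "K \<subseteq> Gunits"
  shows "\<exists>M. \<forall>x\<in>K. \<exists>y. x * y = 1 \<and> norm y \<le> M"
proof (rule ccontr)
  assume "\<not> ?thesis"
  then have "\<forall>n::nat. \<exists>x\<in>K. \<forall>y. x * y = 1 \<longrightarrow> norm y > real n" by (meson not_le)
  then obtain f where f: "\<And>n. f n \<in> K" "\<And>n y. f n * y = 1 \<Longrightarrow> norm y > real n" by metis
  obtain l r where l: "l \<in> K" "strict_mono r" "(f \<circ> r) \<longlonglongrightarrow> l"
    using assms(1) f(1) unfolding compact_def by metis
  obtain q where q: "l * q = 1" using l(1) assms(2) by (auto simp: Gunits_def)
  have "(\<lambda>n. norm ((f \<circ> r) n - l) * norm q) \<longlonglongrightarrow> norm (l - l) * norm q"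
    by (intro tendsto_intros l(3))
  then have "\<forall>\<^sub>F n in sequentially. norm ((f \<circ> r) n - l) * norm q < 1 / 2"
    by (intro order_tendstoD) auto
  moreover have "\<forall>\<^sub>F n in sequentially. real n \<ge> 2 * norm q" by real_asymp
  ultimately have "\<forall>\<^sub>F n in sequentially. norm ((f \<circ> r) n - l) * norm q < 1 / 2 \<and> real n \<ge> 2 * norm q"
    by (rule eventually_conj)
  then obtain n where n: "norm (f (r n) - l) * norm q < 1 / 2" "real n \<ge> 2 * norm q"
    by (auto simp: eventually_sequentially)
  then obtain y where y: "f (r n) * y = 1" using invertible_perturbation[OF q, of "f (r n)"] by auto
  then have "norm y \<le> 2 * norm q" using n(1) by (intro norm_perturbed_inverse_le[OF q]) auto
  moreover have "real n \<le> real (r n)" using seq_suble[OF l(2)] by simp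
  ultimately show False using f(2)[OF y] n(2) by linarith
qed

text \<open>A common bound for the inverses gives one radius,
  \<open>1 / (\<bar>M\<bar> + 1)\<close>, within which every point near \<open>S\<close> is still
  invertible.\<close>

lemma closure_subset_Gunits:
  fixes S :: "'a::{comm_ring_1, real_normed_algebra_1, banach} set"
  assumes "\<And>x. x \<in> S \<Longrightarrow> \<exists>y. x * y = 1 \<and> norm y \<le> M"
  shows "closure S \<subseteq> Gunits"
proof
  fix x assume "x \<in> closure S"
  moreover have "1 / (\<bar>M\<bar> + 1) > 0" by (simp add: add_nonneg_pos)
  ultimately obtain z where z: "z \<in> S" "dist z x < 1 / (\<bar>M\<bar> + 1)"
    unfolding closure_approachable by blast
  obtain y where y: "z * y = 1" "norm y \<le> M" using assms[OF z(1)] by blast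
  have "norm (x - z) * norm y \<le> norm (x - z) * (\<bar>M\<bar> + 1)" using y(2) by (intro mult_left_mono) auto
  also have "\<dots> < 1" using z(2) by (simp add: dist_norm norm_minus_commute pos_less_divide_eq)
  finally obtain r where "x * r = 1" using invertible_perturbation[OF y(1)] by blast
  then show "x \<in> Gunits" by (auto simp: Gunits_def mult.commute)
qed

section \<open>The equivalences\<close>

lemma ell_invertible_iff:
  fixes a :: "nat \<Rightarrow> 'a::comm_complex_banach_algebra_1"
  assumes "a \<in> ell1"
  shows "ell1_invertible a \<longleftrightarrow> closure (dser a ` halfplane) \<subseteq> Gunits"
    and "closure (dser a ` halfplane) \<subseteq> Gunits \<longleftrightarrow> (\<exists>b \<in> ell1. \<forall>s \<in> halfplane. dser a s * dser b s = 1)"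
proof -
  have ca: "coeff (Ell a) = a" using assms by (rule Ell_inverse)
  have 1: "\<exists>b \<in> ell1. \<forall>s \<in> halfplane. dser a s * dser b s = 1" if inv: "ell1_invertible a"
  proof -
    obtain b where b: "b \<in> ell1" "dconv a b = dunit" using inv unfolding ell1_invertible_def by blast
    have "coeff (Ell a * Ell b) = coeff 1" by (simp add: coeff_times ca Ell_inverse b one_ell.rep_eq)
    then have "dser a s * dser b s = 1" if "s \<in> halfplane" for s
      using dser_times[OF that, of "Ell a" "Ell b"] by (simp add: ca Ell_inverse b(1) dser_one)
    then show ?thesis using b(1) by blast
  qed
  \<comment> \<open>The norm of \<open>b\<close> bounds the inverses of all values simultaneously,
    so invertibility extends to the closure.\<close>
  have 2: "closure (dser a ` halfplane) \<subseteq> Gunits" if "b \<in> ell1" "\<forall>s \<in> halfplane. dser a s * dser b s = 1" for b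
  proof (rule closure_subset_Gunits)
    fix x assume "x \<in> dser a ` halfplane"
    then show "\<exists>y. x * y = 1 \<and> norm y \<le> norm (Ell b)"
      using that norm_dser_le[of _ "Ell b"] by (auto simp: Ell_inverse)
  qed
  \<comment> \<open>The hard direction: compactness turns invertibility on the closure into the
    uniform bound required by \<open>ell_invertible\<close>.\<close>
  have 3: "ell1_invertible a" if cl: "closure (dser a ` halfplane) \<subseteq> Gunits"
  proof -
    have "compact (closure (dser a ` halfplane))"
      using compact_closure_dser_range[of "Ell a"] by (simp add: ca)
    then obtain M where M: "\<forall>x\<in>closure (dser a ` halfplane). \<exists>y. x * y = 1 \<and> norm y \<le> M"
      using compact_units_bounded_inverse[OF _ cl] by blast
    have "bounded_inverse (Ell a) M"
      unfolding bounded_inverse_def ca using M closure_subset[of "dser a ` halfplane"] by blast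
    then obtain q where "Ell a * q = 1" using ell_invertible by blast
    then have "dconv a (coeff q) = dunit" by (metis ca coeff_times one_ell.rep_eq)
    then show ?thesis
      unfolding ell1_invertible_def using coeff[of q] dconv_commute[of a "coeff q"] by auto
  qed
  show "ell1_invertible a \<longleftrightarrow> closure (dser a ` halfplane) \<subseteq> Gunits"
    using 1 2 3 by blast
  show "closure (dser a ` halfplane) \<subseteq> Gunits \<longleftrightarrow> (\<exists>b \<in> ell1. \<forall>s \<in> halfplane. dser a s * dser b s = 1)"
    using 1 2 3 by blast
qed

theorem theorem1:
  fixes a :: "nat \<Rightarrow> 'a::comm_complex_banach_algebra_1"
  assumes "a \<in> ell1"
  shows "(ell1_invertible a \<longleftrightarrow> closure (dser a ` halfplane) \<subseteq> Gunits)
       \<and> (closure (dser a ` halfplane) \<subseteq> Gunits \<longleftrightarrow>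
            (\<exists>b \<in> ell1. \<forall>s \<in> halfplane. dser a s * dser b s = 1))
       \<and> (\<forall>f \<in> (Dfun :: (complex \<Rightarrow> 'a) set).
            (\<exists>g \<in> Dfun. \<forall>s \<in> halfplane. f s * g s = 1) \<longleftrightarrow> closure (f ` halfplane) \<subseteq> Gunits)"
proof (intro conjI ballI)
  show "ell1_invertible a \<longleftrightarrow> closure (dser a ` halfplane) \<subseteq> Gunits"
    by (rule ell_invertible_iff(1)[OF assms])
  show "closure (dser a ` halfplane) \<subseteq> Gunits \<longleftrightarrow>
            (\<exists>b \<in> ell1. \<forall>s \<in> halfplane. dser a s * dser b s = 1)"
    by (rule ell_invertible_iff(2)[OF assms])
next
  fix f :: "complex \<Rightarrow> 'a" assume "f \<in> Dfun"
  then obtain c where c: "c \<in> ell1" "\<And>s. s \<in> halfplane \<Longrightarrow> f s = dser c s" by (auto simp: Dfun_def)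
  \<comment> \<open>\<open>f\<close> and \<open>dser c\<close> are known to agree on
    \<open>halfplane\<close> only; both the range and the inverse condition refer to that set
    alone.\<close>
  have "f ` halfplane = dser c ` halfplane" using c(2) by (rule image_cong[OF refl])
  moreover have "(\<exists>g \<in> Dfun. \<forall>s \<in> halfplane. f s * g s = 1)
      \<longleftrightarrow> (\<exists>b \<in> ell1. \<forall>s \<in> halfplane. dser c s * dser b s = 1)"
  proof
    assume "\<exists>g \<in> Dfun. \<forall>s \<in> halfplane. f s * g s = 1"
    then obtain g b where "\<forall>s \<in> halfplane. f s * g s = 1" "b \<in> ell1" "\<forall>s \<in> halfplane. g s = dser b s"
      by (auto simp: Dfun_def)
    then show "\<exists>b \<in> ell1. \<forall>s \<in> halfplane. dser c s * dser b s = 1" using c(2) by (intro bexI[of _ b]) auto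
  next
    assume "\<exists>b \<in> ell1. \<forall>s \<in> halfplane. dser c s * dser b s = 1"
    then obtain b where "b \<in> ell1" "\<forall>s \<in> halfplane. dser c s * dser b s = 1" by blast
    then show "\<exists>g \<in> Dfun. \<forall>s \<in> halfplane. f s * g s = 1"
      using c(2) by (intro bexI[of _ "dser b"]) (auto simp: Dfun_def)
  qed
  ultimately show "(\<exists>g \<in> Dfun. \<forall>s \<in> halfplane. f s * g s = 1) \<longleftrightarrow> closure (f ` halfplane) \<subseteq> Gunits"
    using ell_invertible_iff(2)[OF c(1)] by simp
qed

end
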